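(* Let $M\ge 2$ be an even integer and $D\ge 1$ an integer, both fixed. There is an algorithm which, given any integer $N\ge D$ and any full-rank matrix $\mathbf{V}\in\mathbb{C}^{N\times D}$, constructs in time $\mathcal{O}(N^{2D})$ (more precisely $\mathcal{O}\big((MN/2)^{2D}\big)$) a set $\mathcal{S}(\mathbf{V})\subseteq\mathcal{A}_M^N$ such that $$\max_{\mathbf{s}\in\mathcal{A}_M^N}\|\mathbf{V}^{\mathcal{H}}\mathbf{s}\|=\max_{\mathbf{s}\in\mathcal{S}(\mathbf{V})}\|\mathbf{V}^{\mathcal{H}}\mathbf{s}\|$$ (that is, $\mathcal{S}(\mathbf{V})$ contains a maximizer of $\|\mathbf{V}^{\mathcal{H}}\mathbf{s}\|$ over $\mathcal{A}_M^N$), and $$|\mathcal{S}(\mathbf{V})|=\sum_{d=1}^{D}\sum_{i=0}^{d-1}\binom{N}{i}\binom{N-i}{2(d-i)-1}\Big(\frac{M}{2}\Big)^{2(d-i)-2}\Big(\frac{M}{2}-1\Big)^{i}=\mathcal{O}(N^{2D-1}).$$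
   Context: $\mathcal{A}_M=\{e^{j2\pi m/M}: m=0,1,\ldots,M-1\}$ is the $M$-ary phase-shift keying alphabet ($j$ is the imaginary unit), $\cdot^{\mathcal{H}}$ is the conjugate transpose, and $\|\cdot\|$ is the Euclidean norm. The problem solved is to find $\mathbf{s}_{\rm opt}\in\arg\max_{\mathbf{s}\in\mathcal{A}_M^N}\|\mathbf{V}^{\mathcal{H}}\mathbf{s}\|$. Time is counted in elementary exact operations on real numbers (arithmetic operations, comparisons, elementary functions); the asymptotic notation is as $N\to\infty$, with $M$ and $D$ fixed. Conventions: $0^0=1$ and $\binom{n}{k}=0$ for $k>n$. *)

theory Defs
  imports
    "HOL-Analysis.L2_Norm"
    "HOL-Library.Landau_Symbols"
    "Jordan_Normal_Form.DL_Rank"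
    "Jordan_Normal_Form.Schur_Decomposition"
begin

definition mpsk :: "nat \<Rightarrow> complex set" where
  "mpsk M = {cis (2 * pi * real m / real M) | m. m < M}"

definition mpsk_vecs :: "nat \<Rightarrow> nat \<Rightarrow> complex vec set" where
  "mpsk_vecs M N = {s \<in> carrier_vec N. \<forall>n<N. s $ n \<in> mpsk M}"

definition euclidean_norm :: "complex vec \<Rightarrow> real" where
  "euclidean_norm v = L2_set (\<lambda>i. cmod (v $ i)) {..<dim_vec v}"

definition objective :: "complex mat \<Rightarrow> complex vec \<Rightarrow> real" where
  "objective V s = euclidean_norm (mat_adjoint V *\<^sub>v s)"

(* All truncated subtractions are harmless: i < d makes both exponents and the lower binomial
   argument genuine, and the term vanishes for i > N since then N choose i = 0. *)
definition num_candidates :: "nat \<Rightarrow> nat \<Rightarrow> nat \<Rightarrow> nat" where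
  "num_candidates M D N =
     (\<Sum>d = 1..D. \<Sum>i = 0..<d.
        (N choose i) * ((N - i) choose (2 * (d - i) - 1)) *
        (M div 2) ^ (2 * (d - i) - 2) * (M div 2 - 1) ^ i)"


text \<open>
  Algorithms are finite programs of a structured language for the real RAM.  Memory consists of
  named arrays of exact real numbers and named arrays of natural numbers; the latter serve for
  addresses and counters, and a scalar variable is the cell 0 of an array.  The only constants
  are integers, and there is no operation (such as rounding) from reals to natural numbers.
  The functions are the total ones of HOL, e.g. \<open>x / 0 = 0\<close>.
\<close>

datatype iexp =
    IConst nat
  | ICell string iexp
  | IAdd iexp iexp
  | ISub iexp iexp
  | IMul iexp iexp

datatype real_op1 = Neg | Sqrt | Exp | Ln | Sin | Cos | Arctan

datatype real_op2 = Plus | Minus | Times | Divide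

datatype rexp =
    RConst int
  | ROfIndex iexp
  | RCell string iexp
  | ROp1 real_op1 rexp
  | ROp2 real_op2 rexp rexp

datatype bexp =
    ILess iexp iexp
  | RLess rexp rexp
  | BNot bexp
  | BAnd bexp bexp

datatype com =
    Skip
  | IAssign string iexp iexp
  | RAssign string iexp rexp
  | Seq com com
  | If bexp com com
  | While bexp com

record memory =
  imem :: "string \<Rightarrow> nat \<Rightarrow> nat"
  rmem :: "string \<Rightarrow> nat \<Rightarrow> real"

fun ival :: "iexp \<Rightarrow> memory \<Rightarrow> nat" where
  "ival (IConst k) \<sigma> = k"
| "ival (ICell x a) \<sigma> = imem \<sigma> x (ival a \<sigma>)"
| "ival (IAdd a b) \<sigma> = ival a \<sigma> + ival b \<sigma>"
| "ival (ISub a b) \<sigma> = ival a \<sigma> - ival b \<sigma>"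
| "ival (IMul a b) \<sigma> = ival a \<sigma> * ival b \<sigma>"

fun op1_val :: "real_op1 \<Rightarrow> real \<Rightarrow> real" where
  "op1_val Neg = uminus"
| "op1_val Sqrt = sqrt"
| "op1_val Exp = exp"
| "op1_val Ln = ln"
| "op1_val Sin = sin"
| "op1_val Cos = cos"
| "op1_val Arctan = arctan"

fun op2_val :: "real_op2 \<Rightarrow> real \<Rightarrow> real \<Rightarrow> real" where
  "op2_val Plus = (+)"
| "op2_val Minus = (-)"
| "op2_val Times = (*)"
| "op2_val Divide = (/)"

fun rval :: "rexp \<Rightarrow> memory \<Rightarrow> real" where
  "rval (RConst k) \<sigma> = of_int k"
| "rval (ROfIndex a) \<sigma> = real (ival a \<sigma>)"
| "rval (RCell x a) \<sigma> = rmem \<sigma> x (ival a \<sigma>)"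
| "rval (ROp1 f e) \<sigma> = op1_val f (rval e \<sigma>)"
| "rval (ROp2 f e1 e2) \<sigma> = op2_val f (rval e1 \<sigma>) (rval e2 \<sigma>)"

fun bval :: "bexp \<Rightarrow> memory \<Rightarrow> bool" where
  "bval (ILess a b) \<sigma> \<longleftrightarrow> ival a \<sigma> < ival b \<sigma>"
| "bval (RLess e1 e2) \<sigma> \<longleftrightarrow> rval e1 \<sigma> < rval e2 \<sigma>"
| "bval (BNot b) \<sigma> \<longleftrightarrow> \<not> bval b \<sigma>"
| "bval (BAnd b1 b2) \<sigma> \<longleftrightarrow> bval b1 \<sigma> \<and> bval b2 \<sigma>"

text \<open>
  Every operation, comparison, constant and memory access costs one unit, including those on
  addresses and counters.
\<close>

fun icost :: "iexp \<Rightarrow> nat" where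
  "icost (IConst k) = 1"
| "icost (ICell x a) = 1 + icost a"
| "icost (IAdd a b) = 1 + icost a + icost b"
| "icost (ISub a b) = 1 + icost a + icost b"
| "icost (IMul a b) = 1 + icost a + icost b"

fun rcost :: "rexp \<Rightarrow> nat" where
  "rcost (RConst k) = 1"
| "rcost (ROfIndex a) = 1 + icost a"
| "rcost (RCell x a) = 1 + icost a"
| "rcost (ROp1 f e) = 1 + rcost e"
| "rcost (ROp2 f e1 e2) = 1 + rcost e1 + rcost e2"

fun bcost :: "bexp \<Rightarrow> nat" where
  "bcost (ILess a b) = 1 + icost a + icost b"
| "bcost (RLess e1 e2) = 1 + rcost e1 + rcost e2"
| "bcost (BNot b) = 1 + bcost b"
| "bcost (BAnd b1 b2) = 1 + bcost b1 + bcost b2"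

definition iwrite :: "string \<Rightarrow> nat \<Rightarrow> nat \<Rightarrow> memory \<Rightarrow> memory" where
  "iwrite x k v \<sigma> = \<sigma>\<lparr>imem := (imem \<sigma>)(x := (imem \<sigma> x)(k := v))\<rparr>"

definition rwrite :: "string \<Rightarrow> nat \<Rightarrow> real \<Rightarrow> memory \<Rightarrow> memory" where
  "rwrite x k v \<sigma> = \<sigma>\<lparr>rmem := (rmem \<sigma>)(x := (rmem \<sigma> x)(k := v))\<rparr>"

text \<open>\<open>run P \<sigma> t \<tau>\<close>: started in \<open>\<sigma>\<close>, the program \<open>P\<close> halts in \<open>\<tau>\<close> after exactly \<open>t\<close> time units.\<close>

inductive run :: "com \<Rightarrow> memory \<Rightarrow> nat \<Rightarrow> memory \<Rightarrow> bool" where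
  Skip: "run Skip \<sigma> 1 \<sigma>"
| IAssign: "run (IAssign x a e) \<sigma> (1 + icost a + icost e) (iwrite x (ival a \<sigma>) (ival e \<sigma>) \<sigma>)"
| RAssign: "run (RAssign x a e) \<sigma> (1 + icost a + rcost e) (rwrite x (ival a \<sigma>) (rval e \<sigma>) \<sigma>)"
| Seq: "run c1 \<sigma> t1 \<rho> \<Longrightarrow> run c2 \<rho> t2 \<tau> \<Longrightarrow> run (Seq c1 c2) \<sigma> (t1 + t2) \<tau>"
| IfTrue: "bval b \<sigma> \<Longrightarrow> run c1 \<sigma> t \<tau> \<Longrightarrow> run (If b c1 c2) \<sigma> (1 + bcost b + t) \<tau>"
| IfFalse: "\<not> bval b \<sigma> \<Longrightarrow> run c2 \<sigma> t \<tau> \<Longrightarrow> run (If b c1 c2) \<sigma> (1 + bcost b + t) \<tau>"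
| WhileFalse: "\<not> bval b \<sigma> \<Longrightarrow> run (While b c) \<sigma> (1 + bcost b) \<sigma>"
| WhileTrue: "bval b \<sigma> \<Longrightarrow> run c \<sigma> t1 \<rho> \<Longrightarrow> run (While b c) \<rho> t2 \<tau> \<Longrightarrow>
    run (While b c) \<sigma> (1 + bcost b + t1 + t2) \<tau>"

inductive_cases run_SkipE: "run Skip \<sigma> t \<tau>"
inductive_cases run_IAssignE: "run (IAssign x a e) \<sigma> t \<tau>"
inductive_cases run_RAssignE: "run (RAssign x a e) \<sigma> t \<tau>"
inductive_cases run_SeqE: "run (Seq c1 c2) \<sigma> t \<tau>"
inductive_cases run_IfE: "run (If b c1 c2) \<sigma> t \<tau>"
inductive_cases run_WhileE: "run (While b c) \<sigma> t \<tau>"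

lemma run_deterministic:
  assumes "run c \<sigma> t \<tau>" and "run c \<sigma> t' \<tau>'"
  shows "t' = t \<and> \<tau>' = \<tau>"
  using assms
proof (induction arbitrary: t' \<tau>' rule: run.induct)
  case (Skip \<sigma>)
  then show ?case by (rule run_SkipE) simp
next
  case (IAssign x a e \<sigma>)
  then show ?case by (rule run_IAssignE) simp
next
  case (RAssign x a e \<sigma>)
  then show ?case by (rule run_RAssignE) simp
next
  case (Seq c1 \<sigma> t1 \<rho> c2 t2 \<tau>)
  from Seq.prems obtain u1 \<rho>' u2 where
    "t' = u1 + u2" "run c1 \<sigma> u1 \<rho>'" "run c2 \<rho>' u2 \<tau>'"
    by (rule run_SeqE)
  moreover from this Seq.IH(1) have "u1 = t1" "\<rho>' = \<rho>" by simp_all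
  ultimately show ?case using Seq.IH(2)[of u2 \<tau>'] by simp
next
  case (IfTrue b \<sigma> c1 t \<tau> c2)
  from IfTrue.prems obtain u where "t' = 1 + bcost b + u" "run c1 \<sigma> u \<tau>'"
    by (rule run_IfE) (simp_all add: IfTrue.hyps(1))
  with IfTrue.IH show ?case by simp
next
  case (IfFalse b \<sigma> c2 t \<tau> c1)
  from IfFalse.prems obtain u where "t' = 1 + bcost b + u" "run c2 \<sigma> u \<tau>'"
    by (rule run_IfE) (simp_all add: IfFalse.hyps(1))
  with IfFalse.IH show ?case by simp
next
  case (WhileFalse b \<sigma> c)
  from WhileFalse.prems show ?case
    by (rule run_WhileE) (simp_all add: WhileFalse.hyps(1))
next
  case (WhileTrue b \<sigma> c t1 \<rho> t2 \<tau>)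
  from WhileTrue.prems obtain u1 \<rho>' u2 where
    "t' = 1 + bcost b + u1 + u2" "run c \<sigma> u1 \<rho>'" "run (While b c) \<rho>' u2 \<tau>'"
    by (rule run_WhileE) (simp_all add: WhileTrue.hyps(1))
  moreover from this WhileTrue.IH(1) have "u1 = t1" "\<rho>' = \<rho>" by simp_all
  ultimately show ?case using WhileTrue.IH(2)[of u2 \<tau>'] by simp
qed

text \<open>
  Input: the number of rows \<open>N\<close> and the real and imaginary parts of \<open>V\<close>, row by row; all other
  cells are 0.
\<close>

definition input_memory :: "nat \<Rightarrow> nat \<Rightarrow> complex mat \<Rightarrow> memory" where
  "input_memory D N V =
     \<lparr>imem = (\<lambda>x k. if x = ''N'' \<and> k = 0 then N else 0),
      rmem = (\<lambda>x k. if k < N * D \<and> x = ''Vre'' then Re (V $$ (k div D, k mod D))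
                    else if k < N * D \<and> x = ''Vim'' then Im (V $$ (k div D, k mod D))
                    else 0)\<rparr>"

text \<open>
  Output: a list of vectors of length \<open>N\<close>; their number is stored in the counter \<open>K\<close>, their
  entries one vector after the other.
\<close>

definition output_vecs :: "nat \<Rightarrow> memory \<Rightarrow> complex vec list" where
  "output_vecs N \<tau> =
     map (\<lambda>k. vec N (\<lambda>n. Complex (rmem \<tau> ''Sre'' (k * N + n)) (rmem \<tau> ''Sim'' (k * N + n))))
       [0..<imem \<tau> ''K'' 0]"

text \<open>A set is constructed by listing its elements without repetition.\<close>

definition constructs_in_time :: "com \<Rightarrow> nat \<Rightarrow> nat \<Rightarrow> complex mat \<Rightarrow> complex vec set \<Rightarrow> nat \<Rightarrow> bool"
  where
  "constructs_in_time P D N V S t \<longleftrightarrow>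
     (\<exists>\<tau>. run P (input_memory D N V) t \<tau> \<and>
          distinct (output_vecs N \<tau>) \<and> set (output_vecs N \<tau>) = S)"

end

theory Submission
  imports Defs "HOL-Library.Nat_Bijection"
begin

text \<open>
  Write \<open>V\<^sup>H s\<close> as \<open>z = \<Sum>n. p n (s n)\<close> with \<open>p n m\<close> in real space of dimension \<open>k = 2 D\<close>.  At a maximizer,
  replacing one symbol cannot increase the norm, so \<open>\<langle>p n (s n) - p n m, z\<rangle> > 0\<close> whenever the two points
  differ: \<open>z\<close> lies in an open cell of the arrangement of all hyperplanes orthogonal to differences
  \<open>g = p n m - p n m'\<close>.

  Project \<open>z\<close> repeatedly onto the nearest hyperplane (restricted to the intersection of those chosen
  before).  By the strict Cauchy-Schwarz inequality, the signs of all differences not in the span of the chosen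
  normals \<open>b\<^sub>0, b\<^sub>1, \<dots>\<close> survive each projection.  Hence, with \<open>c\<close> the Gram-Schmidt vectors of
  \<open>b\<close>, the sign of \<open>\<langle>g, z\<rangle>\<close> is that of the last nonzero \<open>\<langle>g, c\<^sub>j\<rangle>\<close>, however degenerate the arrangement
  is.  After \<open>k - 1\<close> normals only one direction is left, which is obtained from some \<open>\<plusminus>e\<^sub>i\<close>.  So
  \<open>O(N^(k - 1))\<close> tuples of differences suffice, and each of them determines a candidate in time \<open>O(N)\<close> by
  taking the lexicographically largest symbol in every coordinate.

  Having an actual maximizer, the program lists it together with its successors in the base \<open>M\<close>
  numbering of the index vectors (modulo \<open>M^N\<close>).  There are enough of them because the number of candidates is
  part of the multinomial expansion of \<open>((M/2 - 1) + M/2 + 1)^N = M^N\<close>.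
\<close>

section \<open>Lexicographic sign vectors\<close>

text \<open>Vectors are total functions of which only the coordinates below \<open>k\<close> count.
  Accordingly \<open>ip k v v = 0\<close>, and not equality of functions, expresses that a vector
  vanishes.\<close>

definition ip :: "nat \<Rightarrow> (nat \<Rightarrow> real) \<Rightarrow> (nat \<Rightarrow> real) \<Rightarrow> real" where
  "ip k u v = (\<Sum>l<k. u l * v l)"

text \<open>For pairwise orthogonal \<open>c\<close> this is the component of \<open>v\<close>
  orthogonal to the first \<open>j\<close> vectors; zero vectors among them are skipped because
  \<open>x / 0 = 0\<close>.\<close>

definition residual :: "nat \<Rightarrow> (nat \<Rightarrow> nat \<Rightarrow> real) \<Rightarrow> nat \<Rightarrow> (nat \<Rightarrow> real) \<Rightarrow> nat \<Rightarrow> real" where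
  "residual k c j v = (\<lambda>l. v l - (\<Sum>i<j. ip k v (c i) / ip k (c i) (c i) * c i l))"

text \<open>
  No independence is required: \<open>x / 0 = 0\<close> makes a vector in the span of its predecessors contribute the
  zero vector, which the lexicographic sign ignores.
\<close>

function gs :: "nat \<Rightarrow> (nat \<Rightarrow> nat \<Rightarrow> real) \<Rightarrow> nat \<Rightarrow> nat \<Rightarrow> real" where
  "gs k b j = (\<lambda>l. b j l -
     (\<Sum>i\<in>{..<j}. ip k (b j) (gs k b i) / ip k (gs k b i) (gs k b i) * gs k b i l))"
  by pat_completeness auto
termination by (relation "measure (\<lambda>(k, b, j). j)") auto

declare gs.simps [simp del]

lemma gs_residual: "gs k b j = residual k (gs k b) j (b j)"
  by (subst gs.simps) (simp add: residual_def)

text \<open>The highest index decides first: \<open>v\<close> is positive on \<open>c (j - 1) +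
  \<epsilon> c (j - 2) + \<epsilon>^2 c (j - 3) + ...\<close> for all small \<epsilon> > 0.\<close>

primrec lexpos :: "nat \<Rightarrow> (nat \<Rightarrow> nat \<Rightarrow> real) \<Rightarrow> nat \<Rightarrow> (nat \<Rightarrow> real) \<Rightarrow> bool" where
  "lexpos k c 0 v = False"
| "lexpos k c (Suc j) v = (ip k v (c j) > 0 \<or> ip k v (c j) = 0 \<and> lexpos k c j v)"

text \<open>Index \<open>r\<close> stands for \<open>e\<^sub>i\<close> if \<open>r = 2 i\<close> and for \<open>- e\<^sub>i\<close> if \<open>r = 2 i + 1\<close>.\<close>

definition unit_vec_signed :: "nat \<Rightarrow> nat \<Rightarrow> int" where
  "unit_vec_signed r l = (if l = r div 2 then if even r then 1 else - 1 else 0)"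

section \<open>Inner products and the Cauchy-Schwarz inequality\<close>

lemma ip_commute: "ip k u v = ip k v u"
  by (simp add: ip_def mult.commute)

lemma ip_diff: "ip k (\<lambda>l. u l - v l) w = ip k u w - ip k v w"
  by (simp add: ip_def sum_subtractf left_diff_distrib)

lemma ip_diff_right: "ip k w (\<lambda>l. u l - v l) = ip k w u - ip k w v"
  by (simp add: ip_def sum_subtractf right_diff_distrib)

lemma ip_scale: "ip k (\<lambda>l. a * u l) w = a * ip k u w"
  by (simp add: ip_def sum_distrib_left mult.assoc)

lemma ip_sum: "ip k (\<lambda>l. \<Sum>i\<in>A. f i l) w = (\<Sum>i\<in>A. ip k (f i) w)"
  by (simp add: ip_def sum_distrib_right sum.swap[of _ A])

lemma ip_cong: "(\<And>l. l < k \<Longrightarrow> u l = u' l) \<Longrightarrow> (\<And>l. l < k \<Longrightarrow> v l = v' l) \<Longrightarrow> ip k u v = ip k u' v'"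
  by (auto simp: ip_def intro!: sum.cong)

lemma ip_self_nonneg: "ip k v v \<ge> 0"
  by (simp add: ip_def sum_nonneg)

lemma ip_self_eq_0_iff: "ip k v v = 0 \<longleftrightarrow> (\<forall>l<k. v l = 0)"
  by (auto simp: ip_def sum_nonneg_eq_0_iff)

lemma ip_zero_left: "ip k u u = 0 \<Longrightarrow> ip k u v = 0"
  unfolding ip_self_eq_0_iff by (simp add: ip_def)

lemma ip_zero_right: "ip k u u = 0 \<Longrightarrow> ip k v u = 0"
  by (metis ip_zero_left ip_commute)

text \<open>The vector is \<open>ip k v v\<close> times the component of \<open>u\<close> orthogonal
  to \<open>v\<close>, so its squared length involves the Gram determinant. Being free of division,
  the identity yields both Cauchy-Schwarz and its equality case.\<close>

lemma ip_gram:
  "ip k (\<lambda>l. ip k v v * u l - ip k u v * v l) (\<lambda>l. ip k v v * u l - ip k u v * v l) =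
   ip k v v * (ip k u u * ip k v v - (ip k u v)\<^sup>2)"
proof -
  define w where "w = (\<lambda>l. ip k v v * u l - ip k u v * v l)"
  have a: "ip k w x = ip k v v * ip k u x - ip k u v * ip k v x" for x
    unfolding w_def ip_diff ip_scale ..
  have "ip k w w = ip k v v * ip k w u - ip k u v * ip k w v"
    unfolding a[of w] by (simp only: ip_commute[of k u w] ip_commute[of k v w])
  then have "ip k w w = ip k v v * (ip k u u * ip k v v - (ip k u v)\<^sup>2)"
    unfolding a by (simp add: ip_commute[of k v u] power2_eq_square algebra_simps)
  then show ?thesis unfolding w_def .
qed

lemma ip_cauchy_schwarz: "(ip k u v)\<^sup>2 \<le> ip k u u * ip k v v"
proof (cases "ip k v v = 0")
  case True
  then show ?thesis using ip_zero_right[of k v u] by simp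
next
  case False
  then have "ip k v v > 0" using ip_self_nonneg[of k v] by simp
  moreover have "0 \<le> ip k v v * (ip k u u * ip k v v - (ip k u v)\<^sup>2)"
    unfolding ip_gram[symmetric] by (rule ip_self_nonneg)
  ultimately show ?thesis by (simp add: zero_le_mult_iff)
qed

lemma ip_cauchy_schwarz_eqD:
  assumes "(ip k u v)\<^sup>2 = ip k u u * ip k v v" "l < k"
  shows "ip k v v * u l = ip k u v * v l"
proof -
  have "ip k (\<lambda>l. ip k v v * u l - ip k u v * v l) (\<lambda>l. ip k v v * u l - ip k u v * v l) = 0"
    unfolding ip_gram using assms(1) by simp
  then show ?thesis using assms(2) by (simp add: ip_self_eq_0_iff)
qed

lemma lexpos_cong: "(\<And>l. l < k \<Longrightarrow> u l = v l) \<Longrightarrow> lexpos k c j u = lexpos k c j v"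
proof (induction j)
  case (Suc j)
  have "ip k u (c j) = ip k v (c j)" by (rule ip_cong) (simp_all add: Suc.prems)
  then show ?case using Suc by simp
qed simp

lemma lexpos_cong_basis:
  "(\<And>i l. i < j \<Longrightarrow> l < k \<Longrightarrow> c i l = c' i l) \<Longrightarrow> lexpos k c j u = lexpos k c' j u"
proof (induction j)
  case (Suc j)
  have "ip k u (c j) = ip k u (c' j)" by (rule ip_cong) (simp_all add: Suc.prems)
  then show ?case using Suc by simp
qed simp

lemma lexpos_uminus: "lexpos k c j u \<Longrightarrow> \<not> lexpos k c j (\<lambda>l. - u l)"
proof (induction j)
  case (Suc j)
  have "ip k (\<lambda>l. - u l) (c j) = - ip k u (c j)" by (simp add: ip_def sum_negf)
  then show ?case using Suc by auto
qed simp

section \<open>Orthogonal projection and Gram-Schmidt\<close>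

lemma residual_Suc:
  "residual k c (Suc j) v = (\<lambda>l. residual k c j v l - ip k v (c j) / ip k (c j) (c j) * c j l)"
  by (simp add: residual_def algebra_simps)

lemma residual_cong: "(\<And>i. i < j \<Longrightarrow> c i = c' i) \<Longrightarrow> residual k c j v = residual k c' j v"
  unfolding residual_def by (intro ext arg_cong2[where f = "(-)"] refl sum.cong) auto

lemma ip_residual:
  "ip k (residual k c j v) w = ip k v w - (\<Sum>i<j. ip k v (c i) / ip k (c i) (c i) * ip k (c i) w)"
  unfolding residual_def ip_diff ip_sum ip_scale ..

definition orth :: "nat \<Rightarrow> (nat \<Rightarrow> nat \<Rightarrow> real) \<Rightarrow> nat \<Rightarrow> bool" where
  "orth k c j \<longleftrightarrow> (\<forall>i<j. \<forall>i'<j. i \<noteq> i' \<longrightarrow> ip k (c i) (c i') = 0)"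

lemma residual_orth:
  assumes "orth k c j" "i < j"
  shows "ip k (residual k c j v) (c i) = 0"
proof -
  \<comment> \<open>The diagonal term is right even when \<open>c i\<close> is zero: the quotient is
    then 0, and so is \<open>ip k v (c i)\<close>.\<close>
  have "(\<Sum>i'<j. ip k v (c i') / ip k (c i') (c i') * ip k (c i') (c i)) =
        (\<Sum>i'<j. if i' = i then ip k v (c i) else 0)"
    using assms by (intro sum.cong) (auto simp: orth_def ip_zero_right)
  also have "\<dots> = ip k v (c i)" using assms(2) by simp
  finally show ?thesis unfolding ip_residual by simp
qed

lemma ip_residual_orth:
  assumes "\<And>i. i < j \<Longrightarrow> ip k w (c i) = 0"
  shows "ip k (residual k c j v) w = ip k v w"
  unfolding ip_residual using assms by (simp add: ip_commute[of k _ w])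

lemma gs_orth: "orth k (gs k b) j"
proof (induction j)
  case 0
  then show ?case by (simp add: orth_def)
next
  case (Suc j)
  have "ip k (gs k b j) (gs k b i) = 0" if "i < j" for i
    using residual_orth[OF Suc that, of "b j"] by (simp flip: gs_residual)
  moreover from this have "ip k (gs k b i) (gs k b j) = 0" if "i < j" for i
    using that by (subst ip_commute) blast
  ultimately show ?case using Suc by (auto simp: orth_def less_Suc_eq)
qed

text \<open>Allows a tuple to be extended or changed at index \<open>j\<close> without disturbing
  the Gram-Schmidt vectors already built.\<close>

lemma gs_cong: "(\<And>i. i \<le> j \<Longrightarrow> b i = b' i) \<Longrightarrow> gs k b j = gs k b' j"
proof (induction j rule: less_induct)
  case (less j)
  have "residual k (gs k b) j (b j) = residual k (gs k b') j (b j)"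
    by (rule residual_cong) (simp add: less)
  then show ?case
    by (subst (1 2) gs_residual) (simp add: less.prems)
qed

text \<open>
  Parseval's identity; it replaces dimension arguments in what follows.
\<close>

lemma sum_residual_units:
  assumes "orth k c j" "\<And>i. i < j \<Longrightarrow> ip k (c i) (c i) \<noteq> 0"
  shows "(\<Sum>e<k. ip k (residual k c j (\<lambda>l. of_bool (l = e))) (residual k c j (\<lambda>l. of_bool (l = e)))) =
    real k - real j"
proof -
  let ?e = "\<lambda>e l. of_bool (l = e) :: real"
  have ipe: "ip k (?e e) w = w e" if "e < k" for e w
    using that by (simp add: ip_def of_bool_def if_distrib[of "\<lambda>x. x * _"] cong: if_cong)
  have "ip k (residual k c j (?e e)) (residual k c j (?e e)) =
      1 - (\<Sum>i<j. c i e * c i e / ip k (c i) (c i))" if "e < k" for e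
  proof -
    \<comment> \<open>The residual is an orthogonal projection, so the squared length of the image
      of a unit vector is a diagonal entry; the sum over \<open>e\<close> is a trace.\<close>
    have "ip k (residual k c j (?e e)) (residual k c j (?e e)) = ip k (?e e) (residual k c j (?e e))"
      by (rule ip_residual_orth) (rule residual_orth[OF assms(1)])
    also have "\<dots> = residual k c j (?e e) e" by (rule ipe[OF that])
    also have "\<dots> = 1 - (\<Sum>i<j. c i e * c i e / ip k (c i) (c i))"
      by (simp add: residual_def ipe[OF that])
    finally show ?thesis .
  qed
  then have "(\<Sum>e<k. ip k (residual k c j (?e e)) (residual k c j (?e e))) =
      real k - (\<Sum>e<k. \<Sum>i<j. c i e * c i e / ip k (c i) (c i))"
    by (simp add: sum_subtractf)
  also have "(\<Sum>e<k. \<Sum>i<j. c i e * c i e / ip k (c i) (c i)) =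
      (\<Sum>i<j. ip k (c i) (c i) / ip k (c i) (c i))"
    by (subst sum.swap) (simp only: sum_divide_distrib[symmetric] ip_def)
  also have "\<dots> = real j" using assms(2) by simp
  finally show ?thesis .
qed

text \<open>For \<open>j = k\<close> the sum in \<open>sum_residual_units\<close> is 0, so every
  unit vector has residual zero; linearity of the residual extends this to all vectors.\<close>

lemma residual_full:
  assumes "orth k c k" "\<And>i. i < k \<Longrightarrow> ip k (c i) (c i) \<noteq> 0" "l < k"
  shows "residual k c k v l = 0"
proof -
  let ?e = "\<lambda>e l. of_bool (l = e) :: real"
  have "\<forall>e\<in>{..<k}. ip k (residual k c k (?e e)) (residual k c k (?e e)) = 0"
    using sum_residual_units[OF assms(1,2)] by (subst sum_nonneg_eq_0_iff[symmetric]) (auto simp: ip_self_nonneg)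
  then have z: "residual k c k (?e e) l = 0" if "e < k" for e
    using that assms(3) by (simp add: ip_self_eq_0_iff)
  have ipe: "ip k (?e e) w = w e" if "e < k" for e w
    using that by (simp add: ip_def of_bool_def if_distrib[of "\<lambda>x. x * _"] cong: if_cong)
  have "residual k c k v l = (\<Sum>e<k. v e * residual k c k (?e e) l)"
  proof -
    have "(\<Sum>e<k. v e * residual k c k (?e e) l) =
        (\<Sum>e<k. v e * ?e e l) - (\<Sum>e<k. \<Sum>i<k. v e * c i e / ip k (c i) (c i) * c i l)"
      unfolding sum_subtractf[symmetric]
      by (intro sum.cong refl) (simp add: residual_def ipe right_diff_distrib sum_distrib_left mult.assoc)
    also have "(\<Sum>e<k. v e * ?e e l) = v l"
      using assms(3) by (simp add: of_bool_def if_distrib[of "\<lambda>x. _ * x"] cong: if_cong)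
    also have "(\<Sum>e<k. \<Sum>i<k. v e * c i e / ip k (c i) (c i) * c i l) =
        (\<Sum>i<k. ip k v (c i) / ip k (c i) (c i) * c i l)"
      by (subst sum.swap) (simp only: sum_divide_distrib[symmetric] sum_distrib_right[symmetric] ip_def)
    finally show ?thesis by (simp add: residual_def)
  qed
  then show ?thesis using z by simp
qed

section \<open>Iterated projection onto the nearest hyperplane\<close>

text \<open>For orthogonal \<open>c\<close>, \<open>ip k r x\<close> is the value of
  \<open>g\<close> at the projection of \<open>x\<close> onto the intersection of the hyperplanes
  with normals \<open>c i\<close>, \<open>i < j\<close>. Either \<open>g\<close> is still positive
  there, or it vanishes on the whole intersection and its sign is read off from the earlier
  normals.\<close>

definition lex_inv :: "nat \<Rightarrow> (nat \<Rightarrow> real) set \<Rightarrow> (nat \<Rightarrow> real) \<Rightarrow> (nat \<Rightarrow> nat \<Rightarrow> real) \<Rightarrow> nat \<Rightarrow> bool" where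
  "lex_inv k G x c j \<longleftrightarrow> (\<forall>g\<in>G. ip k g x > 0 \<longrightarrow>
     (let r = residual k c j g in ip k r r \<noteq> 0 \<and> ip k r x > 0 \<or> ip k r r = 0 \<and> lexpos k c j g))"

text \<open>A vanishing residual puts \<open>g\<close> in the span of the first \<open>j\<close>
  vectors, hence orthogonal to \<open>c j\<close>; the new leading entry is 0 and passes the
  decision down.\<close>

lemma lexpos_Suc_of_residual_zero:
  assumes "orth k c (Suc j)" "ip k (residual k c j g) (residual k c j g) = 0" "lexpos k c j g"
  shows "lexpos k c (Suc j) g"
proof -
  have "ip k g (c j) = ip k (residual k c j g) (c j)"
    using assms(1) by (subst ip_residual_orth) (auto simp: orth_def)
  also have "\<dots> = 0" using assms(2) by (rule ip_zero_left)
  finally show ?thesis using assms(3) by simp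
qed

text \<open>Positivity of both the residual and \<open>c j\<close> on \<open>x\<close> forces
  \<open>q > 0\<close>, and then \<open>ip k g (c j) = q * ip k (c j) (c j)\<close> is
  positive.\<close>

lemma lexpos_Suc_of_parallel:
  assumes "orth k c (Suc j)" "ip k (c j) x > 0"
    and "ip k (residual k c j g) x > 0"
    and "\<And>l. l < k \<Longrightarrow> residual k c j g l = q * c j l"
  shows "lexpos k c (Suc j) g"
proof -
  have "ip k (residual k c j g) x = ip k (\<lambda>l. q * c j l) x"
    by (rule ip_cong) (simp_all add: assms(4))
  then have "q > 0" using assms(2,3) unfolding ip_scale by (simp add: zero_less_mult_iff)
  have "ip k g (c j) = ip k (residual k c j g) (c j)"
    using assms(1) by (subst ip_residual_orth) (auto simp: orth_def)
  also have "\<dots> = ip k (\<lambda>l. q * c j l) (c j)"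
    by (rule ip_cong) (simp_all add: assms(4))
  finally have "ip k g (c j) = q * ip k (c j) (c j)" unfolding ip_scale .
  moreover have "ip k (c j) (c j) \<noteq> 0" using assms(2) ip_zero_left[of k "c j" x] by force
  ultimately show ?thesis using \<open>q > 0\<close> ip_self_nonneg[of k "c j"] by (simp add: less_le)
qed

text \<open>The hypothesis \<open>nearest\<close> compares squared distances from the projected
  point to the hyperplanes, denominators cleared. If the residual of \<open>g\<close> is not
  parallel to \<open>c j\<close>, strict Cauchy-Schwarz together with this minimality keeps it
  positive at the next projection; if it is parallel or zero, the lexicographic sign settles
  \<open>g\<close>.\<close>

lemma lex_inv_step:
  fixes c :: "nat \<Rightarrow> nat \<Rightarrow> real"
  assumes o: "orth k c (Suc j)" and inv: "lex_inv k G x c j"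
    and h: "h \<in> G" "c j = residual k c j h" "ip k (c j) (c j) \<noteq> 0" "ip k (c j) x > 0"
    and nearest: "\<And>g. g \<in> G \<Longrightarrow> ip k g x > 0 \<Longrightarrow> ip k (residual k c j g) (residual k c j g) \<noteq> 0 \<Longrightarrow>
      (ip k (c j) x)\<^sup>2 * ip k (residual k c j g) (residual k c j g) \<le>
      (ip k (residual k c j g) x)\<^sup>2 * ip k (c j) (c j)"
  shows "lex_inv k G x c (Suc j)"
  unfolding lex_inv_def Let_def
proof (intro ballI impI)
  fix g assume g: "g \<in> G" "ip k g x > 0"
  let ?r = "residual k c j g" and ?r' = "residual k c (Suc j) g"
  have gc: "ip k ?r (c j) = ip k g (c j)"
    using o by (subst ip_residual_orth) (auto simp: orth_def)
  have cpos: "ip k (c j) (c j) > 0" using h(3) ip_self_nonneg[of k "c j"] by simp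
  have r': "?r' l = ?r l - ip k ?r (c j) / ip k (c j) (c j) * c j l" for l
    by (simp add: residual_Suc gc)
  show "ip k ?r' ?r' \<noteq> 0 \<and> ip k ?r' x > 0 \<or> ip k ?r' ?r' = 0 \<and> lexpos k c (Suc j) g"
  proof (cases "ip k ?r ?r = 0")
    case True
    then have "ip k ?r (c j) = 0" by (rule ip_zero_left)
    then have "?r' = ?r" using r' by (simp add: fun_eq_iff)
    moreover have "lexpos k c j g"
      using inv g True by (auto simp: lex_inv_def Let_def)
    ultimately show ?thesis
      using True lexpos_Suc_of_residual_zero[OF o True] by simp
  next
    case False
    then have rx: "ip k ?r x > 0" using inv g by (auto simp: lex_inv_def Let_def)
    show ?thesis
    proof (cases "ip k ?r' ?r' = 0")
      case True
      then have "?r l = ip k ?r (c j) / ip k (c j) (c j) * c j l" if "l < k" for l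
        using that r' by (simp add: ip_self_eq_0_iff)
      with True show ?thesis
        using lexpos_Suc_of_parallel[OF o h(4) rx] by blast
    next
      case f: False
      have "(ip k ?r (c j))\<^sup>2 \<noteq> ip k ?r ?r * ip k (c j) (c j)"
      proof
        assume "(ip k ?r (c j))\<^sup>2 = ip k ?r ?r * ip k (c j) (c j)"
        then have "?r' l = 0" if "l < k" for l
          using ip_cauchy_schwarz_eqD[of k ?r "c j", OF _ that] cpos r'[of l] by (simp add: field_simps)
        with f show False by (simp add: ip_self_eq_0_iff)
      qed
      then have cs: "(ip k ?r (c j))\<^sup>2 < ip k ?r ?r * ip k (c j) (c j)"
        using ip_cauchy_schwarz[of k ?r "c j"] by simp
      have rr: "ip k ?r ?r > 0" using False ip_self_nonneg[of k ?r] by simp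
      \<comment> \<open>Squares are compared because the sign of \<open>ip k ?r (c j)\<close> is
        unknown; when they are removed, only the right-hand side has to be nonnegative.\<close>
      have "(ip k ?r (c j) * ip k (c j) x)\<^sup>2 < (ip k ?r ?r * ip k (c j) (c j)) * (ip k (c j) x)\<^sup>2"
        using cs h(4) by (simp add: power_mult_distrib)
      also have "\<dots> \<le> (ip k ?r x)\<^sup>2 * ip k (c j) (c j) * ip k (c j) (c j)"
        using mult_right_mono[OF nearest[OF g False], of "ip k (c j) (c j)"] cpos
        by (simp add: algebra_simps)
      also have "\<dots> = (ip k ?r x * ip k (c j) (c j))\<^sup>2" by (simp add: power2_eq_square)
      finally have "ip k ?r (c j) * ip k (c j) x < ip k ?r x * ip k (c j) (c j)"
        by (rule power_less_imp_less_base) (use rx cpos in simp)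
      then have "ip k ?r x - ip k ?r (c j) / ip k (c j) (c j) * ip k (c j) x > 0"
        using cpos by (simp add: field_simps)
      moreover have "ip k ?r' x = ip k ?r x - ip k ?r (c j) / ip k (c j) (c j) * ip k (c j) x"
        unfolding residual_Suc ip_diff ip_scale gc ..
      ultimately show ?thesis using f by simp
    qed
  qed
qed

lemma lex_inv_cong: "(\<And>i. i < j \<Longrightarrow> c i = c' i) \<Longrightarrow> lex_inv k G x c j = lex_inv k G x c' j"
  unfolding lex_inv_def
  by (simp add: residual_cong[of j c c'] lexpos_cong_basis[of j k c c'] cong: ball_cong)

text \<open>Each stage appends the normal of the nearest hyperplane whose residual is nonzero; once
  none is left, the zero vector \<open>z\<close> pads the tuple. The last conjunct says that padding
  happens only then: an undecided \<open>g\<close> certifies that all Gram-Schmidt vectors are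
  nonzero.\<close>

lemma greedy_tuple:
  assumes "finite G" "z \<in> G" "\<And>l. z l = 0"
  shows "\<exists>b. (\<forall>i<j. b i \<in> G) \<and> lex_inv k G x (gs k b) j \<and>
    ((\<exists>g\<in>G. ip k g x > 0 \<and>
        ip k (residual k (gs k b) j g) (residual k (gs k b) j g) \<noteq> 0) \<longrightarrow>
     (\<forall>i<j. ip k (gs k b i) (gs k b i) \<noteq> 0))"
proof (induction j)
  case 0
  have "lex_inv k G x (gs k b) 0" for b
    using ip_zero_left[of k _ x] by (fastforce simp: lex_inv_def residual_def Let_def)
  then show ?case by auto
next
  case (Suc j)
  then obtain b where b: "\<And>i. i < j \<Longrightarrow> b i \<in> G" and inv: "lex_inv k G x (gs k b) j"
    and nz: "(\<exists>g\<in>G. ip k g x > 0 \<and>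
        ip k (residual k (gs k b) j g) (residual k (gs k b) j g) \<noteq> 0) \<Longrightarrow>
        (\<forall>i<j. ip k (gs k b i) (gs k b i) \<noteq> 0)" by blast
  let ?R = "residual k (gs k b) j"
  define A where "A = {g\<in>G. ip k g x > 0 \<and> ip k (?R g) (?R g) \<noteq> 0}"
  have gs_upd: "gs k (b(j := h)) i = gs k b i" if "i < j" for h i
    by (rule gs_cong) (use that in auto)
  have R_upd: "residual k (gs k (b(j := h))) j = ?R" for h
    by (rule ext, rule residual_cong) (simp add: gs_upd)
  have gs_j: "gs k (b(j := h)) j = ?R h" for h
    by (subst gs_residual) (simp add: R_upd)
  have inv_upd: "lex_inv k G x (gs k (b(j := h))) j" for h
    using inv by (subst lex_inv_cong[of j _ "gs k b"]) (simp_all add: gs_upd)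
  show ?case
  proof (cases "A = {}")
    case True
    \<comment> \<open>The filler has Gram-Schmidt vector zero and leaves every residual
      unchanged.\<close>
    let ?b = "b(j := z)"
    have ipz: "ip k z w = 0" for w using assms(3) by (simp add: ip_def)
    have c0: "gs k ?b j l = 0" for l
      unfolding gs_j residual_def ipz by (simp add: assms(3))
    then have R: "residual k (gs k ?b) (Suc j) g = ?R g" for g
      by (simp add: residual_Suc R_upd)
    have "ip k (?R g) (?R g) = 0 \<and> lexpos k (gs k ?b) (Suc j) g"
      if "g \<in> G" "ip k g x > 0" for g
    proof -
      have zero: "ip k (?R g) (?R g) = 0" using True that by (auto simp: A_def)
      then have "lexpos k (gs k ?b) j g"
        using inv_upd[of z] that R_upd by (auto simp: lex_inv_def Let_def)
      then show ?thesis
        using zero lexpos_Suc_of_residual_zero[OF gs_orth, of k ?b j g] by (simp add: R_upd)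
    qed
    then have "lex_inv k G x (gs k ?b) (Suc j)" by (simp add: lex_inv_def R Let_def del: lexpos.simps)
    moreover have "\<not> (\<exists>g\<in>G. ip k g x > 0 \<and>
        ip k (residual k (gs k ?b) (Suc j) g) (residual k (gs k ?b) (Suc j) g) \<noteq> 0)"
      using True unfolding R A_def by blast
    moreover have "\<forall>i<Suc j. ?b i \<in> G" using b assms(2) by simp
    ultimately show ?thesis by blast
  next
    case False
    \<comment> \<open>The squared distance from the projected point to the hyperplane orthogonal to
      \<open>?R g\<close>.\<close>
    define \<phi> where "\<phi> = (\<lambda>g. (ip k (?R g) x)\<^sup>2 / ip k (?R g) (?R g))"
    have "finite A" using assms(1) by (simp add: A_def)
    then obtain h where h: "h \<in> A" "\<And>g. g \<in> A \<Longrightarrow> \<phi> h \<le> \<phi> g"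
      using False by (metis arg_min_if_finite(1) arg_min_least)
    let ?b = "b(j := h)"
    have hG: "h \<in> G" "ip k h x > 0" "ip k (?R h) (?R h) \<noteq> 0" using h(1) by (auto simp: A_def)
    have pos: "ip k (?R g) (?R g) > 0" if "g \<in> A" for g
      using that ip_self_nonneg[of k "?R g"] by (simp add: A_def less_le)
    have "lex_inv k G x (gs k ?b) (Suc j)"
    proof (rule lex_inv_step[OF gs_orth inv_upd hG(1)])
      show "gs k ?b j = residual k (gs k ?b) j h" by (simp add: gs_j R_upd)
      show "ip k (gs k ?b j) (gs k ?b j) \<noteq> 0" using hG(3) by (simp add: gs_j)
      show "ip k (gs k ?b j) x > 0" using inv hG by (auto simp: gs_j lex_inv_def Let_def)
    next
      fix g assume "g \<in> G" "ip k g x > 0"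
        "ip k (residual k (gs k ?b) j g) (residual k (gs k ?b) j g) \<noteq> 0"
      then have "g \<in> A" by (simp add: A_def R_upd)
      then have "\<phi> h \<le> \<phi> g" by (rule h(2))
      then show "(ip k (gs k ?b j) x)\<^sup>2 * ip k (residual k (gs k ?b) j g) (residual k (gs k ?b) j g)
        \<le> (ip k (residual k (gs k ?b) j g) x)\<^sup>2 * ip k (gs k ?b j) (gs k ?b j)"
        using pos[OF \<open>g \<in> A\<close>] pos[OF h(1)] by (simp add: \<phi>_def R_upd gs_j divide_le_eq field_simps)
    qed
    moreover have "\<forall>i<Suc j. ip k (gs k ?b i) (gs k ?b i) \<noteq> 0"
      using nz hG by (auto simp: less_Suc_eq gs_j gs_upd)
    moreover have "\<forall>i<Suc j. ?b i \<in> G" using b hG(1) by simp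
    ultimately show ?thesis by blast
  qed
qed

text \<open>After \<open>m\<close> greedy normals in dimension \<open>Suc m\<close>, either every
  sign is decided and any \<open>r\<close> will do, or the normals are independent and their
  orthogonal complement is a line. Some unit vector projects onto a spanning vector of that line,
  and its sign is chosen to be positive on \<open>x\<close>.\<close>

lemma lex_tuple_exists:
  assumes "finite G" "z \<in> G" "\<And>l. z l = 0"
  shows "\<exists>b r. (\<forall>i<m. b i \<in> G) \<and> r < 2 * Suc m \<and> b m = (\<lambda>l. of_int (unit_vec_signed r l)) \<and>
    (\<forall>g\<in>G. ip (Suc m) g x > 0 \<longrightarrow> lexpos (Suc m) (gs (Suc m) b) (Suc m) g)"
proof -
  let ?k = "Suc m"
  from greedy_tuple[OF assms, of m ?k x] obtain b where b: "\<And>i. i < m \<Longrightarrow> b i \<in> G"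
    and inv: "lex_inv ?k G x (gs ?k b) m"
    and nz: "(\<exists>g\<in>G. ip ?k g x > 0 \<and>
        ip ?k (residual ?k (gs ?k b) m g) (residual ?k (gs ?k b) m g) \<noteq> 0) \<Longrightarrow>
        (\<forall>i<m. ip ?k (gs ?k b i) (gs ?k b i) \<noteq> 0)" by blast
  let ?R = "residual ?k (gs ?k b) m"
  define u where "u = (\<lambda>r l. of_int (unit_vec_signed r l) :: real)"
  let ?b = "\<lambda>r. b(m := u r)"
  have gs_upd: "gs ?k (?b r) i = gs ?k b i" if "i < m" for r i
    by (rule gs_cong) (use that in auto)
  have R_upd: "residual ?k (gs ?k (?b r)) m = ?R" for r
    by (rule ext, rule residual_cong) (simp add: gs_upd)
  have gs_m: "gs ?k (?b r) m = ?R (u r)" for r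
    by (subst gs_residual) (simp add: R_upd)
  have inv_upd: "lex_inv ?k G x (gs ?k (?b r)) m" for r
    using inv by (subst lex_inv_cong[of m _ "gs ?k b"]) (simp_all add: gs_upd)
  have zero_case: "lexpos ?k (gs ?k (?b r)) ?k g"
    if "g \<in> G" "ip ?k g x > 0" "ip ?k (?R g) (?R g) = 0" for g r
  proof (rule lexpos_Suc_of_residual_zero[OF gs_orth])
    show "ip ?k (residual ?k (gs ?k (?b r)) m g) (residual ?k (gs ?k (?b r)) m g) = 0"
      using that by (simp add: R_upd)
    then show "lexpos ?k (gs ?k (?b r)) m g"
      using inv_upd[of r] that by (auto simp: lex_inv_def Let_def)
  qed
  have "\<exists>r<2 * ?k. \<forall>g\<in>G. ip ?k g x > 0 \<longrightarrow> lexpos ?k (gs ?k (?b r)) ?k g"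
  proof (cases "\<exists>g\<in>G. ip ?k g x > 0 \<and> ip ?k (?R g) (?R g) \<noteq> 0")
    case False
    then show ?thesis by (intro exI[of _ 0]) (auto intro!: zero_case simp del: lexpos.simps)
  next
    case True
    then obtain g0 where g0: "g0 \<in> G" "ip ?k g0 x > 0" "ip ?k (?R g0) (?R g0) \<noteq> 0" by blast
    have nz': "ip ?k (gs ?k b i) (gs ?k b i) \<noteq> 0" if "i < m" for i
      using nz[OF True] that by blast
    let ?e = "\<lambda>e l. of_bool (l = e) :: real"
    \<comment> \<open>Parseval with \<open>m\<close> nonzero vectors in dimension
      \<open>Suc m\<close> leaves total squared length 1, so some residual is nonzero.\<close>
    have "(\<Sum>e<?k. ip ?k (?R (?e e)) (?R (?e e))) = 1"
      using sum_residual_units[OF gs_orth nz'] by simp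
    then have "\<exists>e<?k. ip ?k (?R (?e e)) (?R (?e e)) \<noteq> 0"
      using sum.neutral[of "{..<?k}" "\<lambda>e. ip ?k (?R (?e e)) (?R (?e e))"]
      by (metis (mono_tags, lifting) lessThan_iff zero_neq_one)
    then obtain e where e: "e < ?k" "ip ?k (?R (?e e)) (?R (?e e)) \<noteq> 0" by blast
    have u0: "u (2 * e) = ?e e" by (auto simp: u_def unit_vec_signed_def)
    have "u (2 * e + 1) = (\<lambda>l. - ?e e l)" by (auto simp: u_def unit_vec_signed_def)
    then have neg: "?R (u (2 * e + 1)) = (\<lambda>l. - ?R (u (2 * e)) l)"
      unfolding u0 by (auto simp: residual_def ip_def sum_negf)
    \<comment> \<open>With the new direction adjoined the orthogonal system is full, so the residual
      at level \<open>?k\<close> vanishes and the one at level \<open>m\<close> is a multiple of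
      that direction.\<close>
    have par: "\<exists>q. \<forall>l<?k. ?R g l = q * ?R (u (2 * e)) l" for g
    proof -
      let ?c = "gs ?k (?b (2 * e))"
      have "ip ?k (?c i) (?c i) \<noteq> 0" if "i < ?k" for i
      proof (cases "i < m")
        case True
        then show ?thesis using nz' gs_upd by simp
      next
        case False
        then have "i = m" using that by simp
        then show ?thesis using e(2) unfolding u0[symmetric] gs_m[symmetric] by simp
      qed
      then have "residual ?k ?c ?k g l = 0" if "l < ?k" for l
        using residual_full[OF gs_orth] that by blast
      then have "?R g l = ip ?k g (?c m) / ip ?k (?c m) (?c m) * ?R (u (2 * e)) l" if "l < ?k" for l
        using that by (simp add: residual_Suc R_upd gs_m)
      then show ?thesis by blast
    qed
    obtain q where q: "\<And>l. l < ?k \<Longrightarrow> ?R g0 l = q * ?R (u (2 * e)) l" using par by blast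
    \<comment> \<open>Since the residual of \<open>g0\<close> is a multiple of the direction,
      \<open>x\<close> is not orthogonal to the direction, and one of its two signs is positive on
      \<open>x\<close>.\<close>
    have "ip ?k (?R g0) x > 0" using inv g0 by (auto simp: lex_inv_def Let_def)
    moreover have "ip ?k (?R g0) x = ip ?k (\<lambda>l. q * ?R (u (2 * e)) l) x"
      by (rule ip_cong) (simp_all add: q)
    ultimately have "ip ?k (?R (u (2 * e))) x \<noteq> 0" unfolding ip_scale by auto
    moreover have "ip ?k (?R (u (2 * e + 1))) x = - ip ?k (?R (u (2 * e))) x"
      unfolding neg by (simp add: ip_def sum_negf)
    ultimately obtain r where r: "r = 2 * e \<or> r = 2 * e + 1" "ip ?k (?R (u r)) x > 0"
      by (metis linorder_neqE_linordered_idom neg_0_less_iff_less)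
    have par_r: "\<exists>q. \<forall>l<?k. ?R g l = q * ?R (u r) l" for g
      using par[of g] r(1) neg by (metis minus_mult_minus)
    show ?thesis
    proof (intro exI[of _ r] conjI ballI impI)
      show "r < 2 * ?k" using r(1) e(1) by auto
      fix g assume g: "g \<in> G" "ip ?k g x > 0"
      show "lexpos ?k (gs ?k (?b r)) ?k g"
      proof (cases "ip ?k (?R g) (?R g) = 0")
        case True
        with g show ?thesis by (rule zero_case)
      next
        case False
        then have "ip ?k (?R g) x > 0" using inv g by (auto simp: lex_inv_def Let_def)
        moreover obtain q where "\<And>l. l < ?k \<Longrightarrow> ?R g l = q * ?R (u r) l" using par_r by blast
        ultimately show ?thesis
          using r(2) by (intro lexpos_Suc_of_parallel[OF gs_orth, where x = x and q = q])
            (simp_all only: R_upd gs_m)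
      qed
    qed
  qed
  then obtain r where "r < 2 * ?k" "\<forall>g\<in>G. ip ?k g x > 0 \<longrightarrow> lexpos ?k (gs ?k (?b r)) ?k g" by blast
  then show ?thesis using b
    by (intro exI[of _ "?b r"] exI[of _ r]) (auto simp: u_def simp del: lexpos.simps)
qed

section \<open>Choosing symbols by lexicographic comparison\<close>

primrec pick :: "nat \<Rightarrow> (nat \<Rightarrow> nat \<Rightarrow> real) \<Rightarrow> (nat \<Rightarrow> nat \<Rightarrow> real) \<Rightarrow> nat \<Rightarrow> nat" where
  "pick k c p 0 = 0"
| "pick k c p (Suc m) =
    (if lexpos k c k (\<lambda>l. p m l - p (pick k c p m) l) then m else pick k c p m)"

lemma pick_less: "M > 0 \<Longrightarrow> pick k c p M < M"
  by (induction M) (auto simp: less_Suc_eq split: if_splits intro: gr_zeroI)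

text \<open>The scan reaches the point of \<open>m\<close> at stage \<open>m\<close> at the latest,
  and antisymmetry keeps it there; transitivity of the comparison is avoided. Only the point is
  recovered, not the index, because different symbols may give equal points.\<close>

lemma pick_eq:
  assumes "m < M" "\<And>m'. m' < M \<Longrightarrow> (\<forall>l<k. p m' l = p m l) \<or> lexpos k c k (\<lambda>l. p m l - p m' l)"
    and "l < k"
  shows "p (pick k c p M) l = p m l"
proof -
  have "M' \<le> M \<Longrightarrow> m < M' \<Longrightarrow> \<forall>l<k. p (pick k c p M') l = p m l" for M'
  proof (induction M')
    case (Suc M')
    let ?s = "pick k c p M'"
    have "?s < M" using pick_less[of M' k c p] Suc.prems by (cases M') auto
    show ?case
    proof (cases "m = M'")
      case True
      then show ?thesis using assms(2)[OF \<open>?s < M\<close>] by auto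
    next
      case False
      then have s: "\<forall>l<k. p ?s l = p m l" using Suc by simp
      show ?thesis
      proof (cases "\<forall>l<k. p M' l = p m l")
        case True
        then show ?thesis using s by simp
      next
        case f: False
        then have "lexpos k c k (\<lambda>l. p m l - p M' l)" using assms(2)[of M'] Suc.prems by auto
        then have "\<not> lexpos k c k (\<lambda>l. p M' l - p m l)" by (drule_tac lexpos_uminus) simp
        then have "\<not> lexpos k c k (\<lambda>l. p M' l - p ?s l)"
          using lexpos_cong[of k "\<lambda>l. p M' l - p ?s l" "\<lambda>l. p M' l - p m l"] s by simp
        then show ?thesis using s by simp
      qed
    qed
  qed simp
  then show ?thesis using assms(1,3) by blast
qed

definition sqnorm_sum :: "nat \<Rightarrow> nat \<Rightarrow> (nat \<Rightarrow> nat \<Rightarrow> nat \<Rightarrow> real) \<Rightarrow> (nat \<Rightarrow> nat) \<Rightarrow> real" where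
  "sqnorm_sum k N p s = (\<Sum>l<k. (\<Sum>n<N. p n (s n) l)\<^sup>2)"

text \<open>
  The index function encodes \<open>L\<close> triples \<open>(n, m, m')\<close>: their components are stored at \<open>j\<close>, \<open>L + j\<close>
  and \<open>2 L + j\<close>.
\<close>

definition hyperplane_tuple ::
  "nat \<Rightarrow> (nat \<Rightarrow> nat \<Rightarrow> nat \<Rightarrow> real) \<Rightarrow> nat \<Rightarrow> (nat \<Rightarrow> nat) \<Rightarrow> nat \<Rightarrow> nat \<Rightarrow> real" where
  "hyperplane_tuple L p r f j l =
     (if j < L then p (f j) (f (L + j)) l - p (f j) (f (2 * L + j)) l
      else of_int (unit_vec_signed r l))"

text \<open>Exchanging the symbol in coordinate \<open>n\<close> turns the sum \<open>z\<close> into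
  \<open>z - g\<close>. From |z - g|^2 \<le> |z|^2 follows 2<g, z> \<ge> |g|^2, which is positive
  unless \<open>g\<close> vanishes.\<close>

lemma maximizer_strict:
  assumes max: "\<And>s'. (\<forall>n<N. s' n < M) \<Longrightarrow> sqnorm_sum k N p s' \<le> sqnorm_sum k N p s"
    and s: "\<And>n. n < N \<Longrightarrow> s n < M" and n: "n < N" and m: "m < M"
  shows "(\<forall>l<k. p n m l = p n (s n) l) \<or>
    ip k (\<lambda>l. p n (s n) l - p n m l) (\<lambda>l. \<Sum>n<N. p n (s n) l) > 0"
proof -
  let ?g = "\<lambda>l. p n (s n) l - p n m l" and ?z = "\<lambda>l. \<Sum>n<N. p n (s n) l"
  have "(\<Sum>n'<N. p n' ((s(n := m)) n') l) = ?z l - ?g l" for l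
    using n by (simp add: sum.remove[of "{..<N}" n])
  then have "sqnorm_sum k N p (s(n := m)) = ip k (\<lambda>l. ?z l - ?g l) (\<lambda>l. ?z l - ?g l)"
    by (simp add: sqnorm_sum_def ip_def power2_eq_square)
  also have "\<dots> = ip k ?z ?z - 2 * ip k ?g ?z + ip k ?g ?g"
    unfolding ip_diff ip_diff_right by (simp add: ip_commute[of k ?z "p n m"] ip_commute[of k ?z "p n (s n)"])
  finally have "ip k ?z ?z - 2 * ip k ?g ?z + ip k ?g ?g \<le> ip k ?z ?z"
    using max[of "s(n := m)"] s m by (simp add: sqnorm_sum_def ip_def power2_eq_square)
  then have "2 * ip k ?g ?z \<ge> ip k ?g ?g" by simp
  moreover have "ip k ?g ?g > 0 \<or> (\<forall>l<k. ?g l = 0)"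
    using ip_self_nonneg[of k ?g] ip_self_eq_0_iff[of k ?g] by (metis less_le)
  ultimately show ?thesis by auto
qed

text \<open>\<open>lex_tuple_exists\<close> is applied to the set of all differences and the optimal
  sum \<open>z\<close>. By \<open>maximizer_strict\<close> the lexicographic comparison then prefers
  the optimal point in every coordinate, and \<open>pick\<close> finds it.\<close>

lemma tuple_finds_maximizer:
  assumes max: "\<And>s'. (\<forall>n<N. s' n < M) \<Longrightarrow> sqnorm_sum (Suc L) N p s' \<le> sqnorm_sum (Suc L) N p s"
    and s: "\<And>n. n < N \<Longrightarrow> s n < M" and "N > 0" "M > 0"
  shows "\<exists>f r. (\<forall>j<L. f j < N) \<and> (\<forall>j<2 * L. f (L + j) < M) \<and> r < 2 * Suc L \<and>
    sqnorm_sum (Suc L) N p (\<lambda>n. pick (Suc L) (gs (Suc L) (hyperplane_tuple L p r f)) (p n) M) =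
    sqnorm_sum (Suc L) N p s"
proof -
  let ?k = "Suc L"
  define d where "d = (\<lambda>(n, m, m') l. p n m l - p n m' l)"
  define T where "T = {..<N} \<times> {..<M} \<times> {..<M}"
  define z where "z = (\<lambda>l. \<Sum>n<N. p n (s n) l)"
  have "finite (d ` T)" by (simp add: T_def)
  \<comment> \<open>This difference of a point with itself is the zero vector needed for padding; it
    exists because \<open>N\<close> and \<open>M\<close> are positive.\<close>
  moreover have "d (0, 0, 0) \<in> d ` T" using assms(3,4) by (auto simp: T_def)
  moreover have "d (0, 0, 0) l = 0" for l by (simp add: d_def)
  ultimately obtain b r where b: "\<And>i. i < L \<Longrightarrow> b i \<in> d ` T" and r: "r < 2 * ?k"
    and bL: "b L = (\<lambda>l. of_int (unit_vec_signed r l))"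
    and lp: "\<And>g. g \<in> d ` T \<Longrightarrow> ip ?k g z > 0 \<Longrightarrow> lexpos ?k (gs ?k b) ?k g"
    using lex_tuple_exists[of "d ` T" "d (0, 0, 0)" L z] by blast
  have "\<forall>i\<in>{..<L}. \<exists>y. y \<in> T \<and> b i = d y" using b by fast
  from bchoice[OF this]
  obtain t where t: "\<And>i. i < L \<Longrightarrow> t i \<in> T" "\<And>i. i < L \<Longrightarrow> b i = d (t i)" by auto
  \<comment> \<open>The triples are laid out as the counters of the nested loops will hold
    them.\<close>
  define f where "f = (\<lambda>i. if i < L then fst (t i) else if i < 2 * L then fst (snd (t (i - L)))
    else snd (snd (t (i - 2 * L))))"
  have f: "f j = fst (t j)" "f (L + j) = fst (snd (t j))" "f (2 * L + j) = snd (snd (t j))"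
    if "j < L" for j using that by (auto simp: f_def)
  have "hyperplane_tuple L p r f i = b i" if "i \<le> L" for i
  proof (cases "i < L")
    case True
    then show ?thesis using t(2)[OF True] f[OF True]
      by (auto simp: hyperplane_tuple_def d_def split: prod.splits)
  next
    case False
    then show ?thesis using that bL by (simp add: hyperplane_tuple_def fun_eq_iff)
  qed
  then have gs_eq: "gs ?k (hyperplane_tuple L p r f) i = gs ?k b i" if "i < ?k" for i
    using that by (intro gs_cong) simp
  let ?c = "gs ?k (hyperplane_tuple L p r f)"
  have pick_n: "p n (pick ?k ?c (p n) M) l = p n (s n) l" if "n < N" "l < ?k" for n l
  proof (rule pick_eq[OF s[OF that(1)] _ that(2)])
    fix m assume m: "m < M"
    have "(\<forall>l<?k. p n m l = p n (s n) l) \<or> ip ?k (\<lambda>l. p n (s n) l - p n m l) z > 0"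
      unfolding z_def by (rule maximizer_strict[OF max s that(1) m])
    moreover have "(\<lambda>l. p n (s n) l - p n m l) \<in> d ` T"
      using that(1) m s by (intro image_eqI[of _ _ "(n, s n, m)"]) (auto simp: d_def T_def)
    ultimately have "(\<forall>l<?k. p n m l = p n (s n) l) \<or>
        lexpos ?k (gs ?k b) ?k (\<lambda>l. p n (s n) l - p n m l)"
      using lp by blast
    then show "(\<forall>l<?k. p n m l = p n (s n) l) \<or> lexpos ?k ?c ?k (\<lambda>l. p n (s n) l - p n m l)"
      by (subst lexpos_cong_basis[of ?k ?k ?c "gs ?k b"]) (simp_all only: gs_eq)
  qed
  have "f j < N" if "j < L" for j using t(1)[OF that] f[OF that] by (auto simp: T_def)
  moreover have "f (L + j) < M" if "j < 2 * L" for j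
  proof (cases "j < L")
    case True
    then show ?thesis using t(1)[OF True] f[OF True] by (auto simp: T_def)
  next
    case False
    then have "L + j = 2 * L + (j - L)" "j - L < L" using that by auto
    then show ?thesis using t(1)[of "j - L"] f[of "j - L"] by (auto simp: T_def)
  qed
  moreover have "sqnorm_sum ?k N p (\<lambda>n. pick ?k ?c (p n) M) = sqnorm_sum ?k N p s"
    unfolding sqnorm_sum_def by (intro sum.cong refl arg_cong[where f = "\<lambda>x. x\<^sup>2"]) (simp add: pick_n)
  ultimately show ?thesis using r by blast
qed

section \<open>A cost calculus for programs\<close>

text \<open>Total correctness with an upper bound on the time, so that branches of different length
  can share one bound.\<close>

definition wp :: "com \<Rightarrow> nat \<Rightarrow> (memory \<Rightarrow> bool) \<Rightarrow> memory \<Rightarrow> bool" where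
  "wp c T Q \<sigma> \<longleftrightarrow> (\<exists>t \<tau>. run c \<sigma> t \<tau> \<and> t \<le> T \<and> Q \<tau>)"

lemma wp_mono: "wp c T Q \<sigma> \<Longrightarrow> (\<And>\<tau>. Q \<tau> \<Longrightarrow> Q' \<tau>) \<Longrightarrow> T \<le> T' \<Longrightarrow> wp c T' Q' \<sigma>"
  by (force simp: wp_def)

lemma wp_run: "run c \<sigma> t \<tau> \<Longrightarrow> Q \<tau> \<Longrightarrow> wp c t Q \<sigma>"
  by (auto simp: wp_def)

lemma wp_Seq:
  assumes "wp c1 T1 R \<sigma>" "\<And>\<rho>. R \<rho> \<Longrightarrow> wp c2 T2 Q \<rho>"
  shows "wp (Seq c1 c2) (T1 + T2) Q \<sigma>"
  using assms unfolding wp_def by (meson run.Seq add_mono)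

lemma wp_If:
  assumes "bval b \<sigma> \<Longrightarrow> wp c1 T Q \<sigma>" "\<not> bval b \<sigma> \<Longrightarrow> wp c2 T Q \<sigma>"
  shows "wp (If b c1 c2) (1 + bcost b + T) Q \<sigma>"
proof (cases "bval b \<sigma>")
  case True
  then show ?thesis using assms(1) unfolding wp_def by (meson run.IfTrue add_left_mono)
next
  case False
  then show ?thesis using assms(2) unfolding wp_def by (meson run.IfFalse add_left_mono)
qed

primrec loopfree :: "com \<Rightarrow> bool" where
  "loopfree Skip = True"
| "loopfree (IAssign x a e) = True"
| "loopfree (RAssign x a e) = True"
| "loopfree (Seq c1 c2) = (loopfree c1 \<and> loopfree c2)"
| "loopfree (If b c1 c2) = (loopfree c1 \<and> loopfree c2)"
| "loopfree (While b c) = False"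

primrec exec :: "com \<Rightarrow> memory \<Rightarrow> memory" where
  "exec Skip \<sigma> = \<sigma>"
| "exec (IAssign x a e) \<sigma> = iwrite x (ival a \<sigma>) (ival e \<sigma>) \<sigma>"
| "exec (RAssign x a e) \<sigma> = rwrite x (ival a \<sigma>) (rval e \<sigma>) \<sigma>"
| "exec (Seq c1 c2) \<sigma> = exec c2 (exec c1 \<sigma>)"
| "exec (If b c1 c2) \<sigma> = (if bval b \<sigma> then exec c1 \<sigma> else exec c2 \<sigma>)"
| "exec (While b c) \<sigma> = \<sigma>"

text \<open>A bound independent of the memory: both branches of a conditional are added. The value
  at \<open>While\<close> is a dummy, since only loop-free programs are measured this way.\<close>

primrec cost :: "com \<Rightarrow> nat" where
  "cost Skip = 1"
| "cost (IAssign x a e) = 1 + icost a + icost e"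
| "cost (RAssign x a e) = 1 + icost a + rcost e"
| "cost (Seq c1 c2) = cost c1 + cost c2"
| "cost (If b c1 c2) = 1 + bcost b + (cost c1 + cost c2)"
| "cost (While b c) = 0"

lemma wp_exec: "loopfree c \<Longrightarrow> Q (exec c \<sigma>) \<Longrightarrow> wp c (cost c) Q \<sigma>"
proof (induction c arbitrary: Q \<sigma>)
  case (Seq c1 c2)
  show ?case unfolding cost.simps
    by (rule wp_Seq[of _ _ "\<lambda>\<rho>. \<rho> = exec c1 \<sigma>"]) (use Seq in auto)
next
  case (If b c1 c2)
  show ?case unfolding cost.simps
    by (rule wp_If; rule wp_mono[where Q = Q]) (use If in auto)
qed (use wp_run[OF run.Skip] wp_run[OF run.IAssign] wp_run[OF run.RAssign] in auto)

text \<open>Iteration over ranges depending on \<open>M\<close> and \<open>D\<close> alone is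
  expanded in the program text, so that it costs a constant; genuine loops remain for ranges
  depending on \<open>N\<close>.\<close>

primrec unroll :: "nat \<Rightarrow> (nat \<Rightarrow> com) \<Rightarrow> com" where
  "unroll 0 b = Skip"
| "unroll (Suc n) b = Seq (unroll n b) (b n)"

lemma loopfree_unroll: "(\<And>i. i < n \<Longrightarrow> loopfree (b i)) \<Longrightarrow> loopfree (unroll n b)"
  by (induction n) auto

lemma exec_unroll:
  assumes "Inv 0 \<sigma>" "\<And>i \<rho>. i < n \<Longrightarrow> Inv i \<rho> \<Longrightarrow> Inv (Suc i) (exec (b i) \<rho>)"
  shows "Inv n (exec (unroll n b) \<sigma>)"
  using assms by (induction n) auto

lemma wp_unroll:
  assumes "Inv 0 \<sigma>" "\<And>i \<rho>. i < n \<Longrightarrow> Inv i \<rho> \<Longrightarrow> wp (b i) (T i) (Inv (Suc i)) \<rho>"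
  shows "wp (unroll n b) (1 + (\<Sum>i<n. T i)) (Inv n) \<sigma>"
  using assms
proof (induction n)
  case 0
  then show ?case using wp_exec[of Skip "Inv 0" \<sigma>] by simp
next
  case (Suc n)
  have "wp (Seq (unroll n b) (b n)) ((1 + (\<Sum>i<n. T i)) + T n) (Inv (Suc n)) \<sigma>"
    by (rule wp_Seq[of _ _ "Inv n"]) (use Suc in auto)
  then show ?case by (simp add: add.commute add.left_commute)
qed

definition For :: "string \<Rightarrow> nat \<Rightarrow> iexp \<Rightarrow> com \<Rightarrow> com" where
  "For a d bnd c = Seq (IAssign a (IConst d) (IConst 0))
     (While (ILess (ICell a (IConst d)) bnd)
       (Seq c (IAssign a (IConst d) (IAdd (ICell a (IConst d)) (IConst 1)))))"

text \<open>\<open>Inv i\<close> speaks of the memory right after the counter has become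
  \<open>i\<close>, and the body must leave the counter unchanged. Guard, body and increment take at
  most \<open>T + icost bnd + 10\<close>; the additional round in \<open>Suc n\<close> pays for the
  initialization and the failing last test.\<close>

lemma wp_For:
  assumes init: "Inv 0 (iwrite a d 0 \<sigma>)"
    and bnd: "\<And>i \<rho>. i \<le> n \<Longrightarrow> Inv i \<rho> \<Longrightarrow> ival bnd \<rho> = n"
    and step: "\<And>i \<rho>. i < n \<Longrightarrow> Inv i \<rho> \<Longrightarrow> imem \<rho> a d = i \<Longrightarrow>
      wp c T (\<lambda>\<tau>. imem \<tau> a d = i \<and> Inv (Suc i) (iwrite a d (Suc i) \<tau>)) \<rho>"
  shows "wp (For a d bnd c) (Suc n * (T + icost bnd + 12)) (\<lambda>\<tau>. Inv n \<tau> \<and> imem \<tau> a d = n) \<sigma>"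
proof -
  let ?inc = "IAssign a (IConst d) (IAdd (ICell a (IConst d)) (IConst 1))"
  let ?b = "ILess (ICell a (IConst d)) bnd"
  let ?W = "While ?b (Seq c ?inc)"
  have "wp ?W ((n - i) * (T + icost bnd + 12) + icost bnd + 5) (\<lambda>\<tau>. Inv n \<tau> \<and> imem \<tau> a d = n) \<rho>"
    if "i \<le> n" "Inv i \<rho>" "imem \<rho> a d = i" for i \<rho>
    using that
  proof (induction "n - i" arbitrary: i \<rho>)
    case 0
    then have "i = n" by simp
    then have "run ?W \<rho> (1 + bcost ?b) \<rho>" using 0 bnd[of n \<rho>] by (intro run.WhileFalse) simp
    then show ?case using \<open>i = n\<close> 0 unfolding wp_def
      by (intro exI[of _ "1 + bcost ?b"] exI[of _ \<rho>]) simp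
  next
    case (Suc q)
    then have "i < n" by simp
    have guard: "bval ?b \<rho>" using Suc bnd[of i \<rho>] by simp
    obtain t \<tau> where t: "run c \<rho> t \<tau>" "t \<le> T" "imem \<tau> a d = i" "Inv (Suc i) (iwrite a d (Suc i) \<tau>)"
      using step[OF \<open>i < n\<close> Suc.prems(2,3)] unfolding wp_def by blast
    let ?\<tau> = "iwrite a d (Suc i) \<tau>"
    have "run ?inc \<tau> 6 ?\<tau>"
      using run.IAssign[of a "IConst d" "IAdd (ICell a (IConst d)) (IConst 1)" \<tau>] t(3)
      by (simp add: eval_nat_numeral)
    with t(1) have body: "run (Seq c ?inc) \<rho> (t + 6) ?\<tau>" by (rule run.Seq)
    have "wp ?W ((n - Suc i) * (T + icost bnd + 12) + icost bnd + 5)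
        (\<lambda>\<tau>. Inv n \<tau> \<and> imem \<tau> a d = n) ?\<tau>"
      by (rule Suc.hyps(1)) (use Suc t(4) in \<open>auto simp: iwrite_def\<close>)
    then obtain u \<phi> where u: "run ?W ?\<tau> u \<phi>"
      "u \<le> (n - Suc i) * (T + icost bnd + 12) + icost bnd + 5" "Inv n \<phi>" "imem \<phi> a d = n"
      unfolding wp_def by blast
    have "run ?W \<rho> (1 + bcost ?b + (t + 6) + u) \<phi>"
      by (rule run.WhileTrue[OF guard body u(1)])
    moreover have "1 + bcost ?b + (t + 6) + u \<le> (n - i) * (T + icost bnd + 12) + icost bnd + 5"
    proof -
      have "n - i = Suc (n - Suc i)" using \<open>i < n\<close> by simp
      then show ?thesis using t(2) u(2) by simp
    qed
    ultimately show ?case using u(3,4) unfolding wp_def by blast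
  qed
  from this[of 0 "iwrite a d 0 \<sigma>"]
  have w: "wp ?W (n * (T + icost bnd + 12) + icost bnd + 5) (\<lambda>\<tau>. Inv n \<tau> \<and> imem \<tau> a d = n) (iwrite a d 0 \<sigma>)"
    using init by (simp add: iwrite_def)
  have "wp (For a d bnd c) (3 + (n * (T + icost bnd + 12) + icost bnd + 5)) (\<lambda>\<tau>. Inv n \<tau> \<and> imem \<tau> a d = n) \<sigma>"
    unfolding For_def
  proof (rule wp_Seq[of _ _ "\<lambda>\<rho>. \<rho> = iwrite a d 0 \<sigma>"])
    show "wp (IAssign a (IConst d) (IConst 0)) 3 (\<lambda>\<rho>. \<rho> = iwrite a d 0 \<sigma>) \<sigma>"
      using wp_exec[of "IAssign a (IConst d) (IConst 0)" "\<lambda>\<rho>. \<rho> = iwrite a d 0 \<sigma>" \<sigma>]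
      by (simp add: eval_nat_numeral)
  qed (use w in simp)
  then show ?thesis by (rule wp_mono) auto
qed

lemma imem_iwrite: "imem (iwrite x k v \<sigma>) = (imem \<sigma>)(x := (imem \<sigma> x)(k := v))"
  and rmem_iwrite: "rmem (iwrite x k v \<sigma>) = rmem \<sigma>"
  and imem_rwrite: "imem (rwrite x k w \<sigma>) = imem \<sigma>"
  and rmem_rwrite: "rmem (rwrite x k w \<sigma>) = (rmem \<sigma>)(x := (rmem \<sigma> x)(k := w))"
  by (simp_all add: iwrite_def rwrite_def)

lemmas mem_simps = imem_iwrite rmem_iwrite imem_rwrite rmem_rwrite

primrec isum :: "nat \<Rightarrow> (nat \<Rightarrow> iexp) \<Rightarrow> iexp" where
  "isum 0 f = IConst 0"
| "isum (Suc n) f = IAdd (isum n f) (f n)"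

primrec rsum :: "nat \<Rightarrow> (nat \<Rightarrow> rexp) \<Rightarrow> rexp" where
  "rsum 0 f = RConst 0"
| "rsum (Suc n) f = ROp2 Plus (rsum n f) (f n)"

lemma ival_isum: "ival (isum n f) \<sigma> = (\<Sum>i<n. ival (f i) \<sigma>)"
  by (induction n) auto

lemma rval_rsum: "rval (rsum n f) \<sigma> = (\<Sum>i<n. rval (f i) \<sigma>)"
  by (induction n) auto

text \<open>Cell \<open>j\<close> of \<open>''i''\<close> is the counter of the loop at level
  \<open>j\<close>, level 0 being innermost, so the body sees a whole index tuple in one
  array.\<close>

primrec nest :: "(nat \<Rightarrow> iexp) \<Rightarrow> nat \<Rightarrow> com \<Rightarrow> com" where
  "nest bnd 0 c = c"
| "nest bnd (Suc d) c = For ''i'' d (bnd d) (nest bnd d c)"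

primrec nest_time :: "(nat \<Rightarrow> nat) \<Rightarrow> nat \<Rightarrow> nat \<Rightarrow> nat" where
  "nest_time bv 0 T = T"
| "nest_time bv (Suc d) T = Suc (bv d) * (nest_time bv d T + 14)"

text \<open>\<open>Done f\<close> is a permanent record that the body has been run with counters
  \<open>f\<close>: the body establishes it, and neither further runs nor counter writes destroy it.
  Induction on the depth, with the outer counters frozen, covers the whole box of tuples.\<close>

lemma wp_nest:
  assumes body: "\<And>\<rho>. I \<rho> \<Longrightarrow> (\<And>j. j < L \<Longrightarrow> imem \<rho> ''i'' j < bv j) \<Longrightarrow>
      wp c T (\<lambda>\<tau>. I \<tau> \<and> imem \<tau> ''i'' = imem \<rho> ''i'' \<and> Done (imem \<rho> ''i'') \<tau> \<and>
        (\<forall>f. Done f \<rho> \<longrightarrow> Done f \<tau>)) \<rho>"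
    and stable: "\<And>\<rho> k v. I \<rho> \<Longrightarrow> I (iwrite ''i'' k v \<rho>)"
      "\<And>\<rho> f k v. Done f (iwrite ''i'' k v \<rho>) = Done f \<rho>"
    and bnd: "\<And>\<rho> d. I \<rho> \<Longrightarrow> d < L \<Longrightarrow> ival (bnd d) \<rho> = bv d" "\<And>d. icost (bnd d) \<le> 2"
    and "d \<le> L" "I \<sigma>" "\<And>j. d \<le> j \<Longrightarrow> j < L \<Longrightarrow> imem \<sigma> ''i'' j < bv j"
  shows "wp (nest bnd d c) (nest_time bv d T)
    (\<lambda>\<tau>. I \<tau> \<and> (\<forall>j\<ge>d. imem \<tau> ''i'' j = imem \<sigma> ''i'' j) \<and> (\<forall>f. Done f \<sigma> \<longrightarrow> Done f \<tau>) \<and>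
      (\<forall>f. (\<forall>j<d. f j < bv j) \<and> (\<forall>j\<ge>d. f j = imem \<sigma> ''i'' j) \<longrightarrow> Done f \<tau>)) \<sigma>"
  using assms(6-8)
proof (induction d arbitrary: \<sigma>)
  case 0
  have "wp c T (\<lambda>\<tau>. I \<tau> \<and> imem \<tau> ''i'' = imem \<sigma> ''i'' \<and> Done (imem \<sigma> ''i'') \<tau> \<and>
        (\<forall>f. Done f \<sigma> \<longrightarrow> Done f \<tau>)) \<sigma>"
    using 0 by (intro body) auto
  then show ?case unfolding nest.simps nest_time.simps
  proof (rule wp_mono)
    fix \<tau> assume t: "I \<tau> \<and> imem \<tau> ''i'' = imem \<sigma> ''i'' \<and> Done (imem \<sigma> ''i'') \<tau> \<and>
        (\<forall>f. Done f \<sigma> \<longrightarrow> Done f \<tau>)"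
    have "Done f \<tau>" if "\<forall>j\<ge>0. f j = imem \<sigma> ''i'' j" for f
    proof -
      have "f = imem \<sigma> ''i''" using that by auto
      with t show ?thesis by simp
    qed
    with t show "I \<tau> \<and> (\<forall>j\<ge>0. imem \<tau> ''i'' j = imem \<sigma> ''i'' j) \<and> (\<forall>f. Done f \<sigma> \<longrightarrow> Done f \<tau>) \<and>
      (\<forall>f. (\<forall>j<0. f j < bv j) \<and> (\<forall>j\<ge>0. f j = imem \<sigma> ''i'' j) \<longrightarrow> Done f \<tau>)" by simp
  qed simp
next
  case (Suc d)
  \<comment> \<open>After \<open>i\<close> rounds at level \<open>d\<close> the tuples with entry
    \<open>d\<close> below \<open>i\<close> are done, for all values of the inner counters.\<close>
  define Inv where "Inv = (\<lambda>i \<rho>. I \<rho> \<and> (\<forall>j\<ge>Suc d. imem \<rho> ''i'' j = imem \<sigma> ''i'' j) \<and>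
    (\<forall>f. Done f \<sigma> \<longrightarrow> Done f \<rho>) \<and>
    (\<forall>f. (\<forall>j<d. f j < bv j) \<and> f d < i \<and> (\<forall>j\<ge>Suc d. f j = imem \<sigma> ''i'' j) \<longrightarrow> Done f \<rho>))"
  have "wp (For ''i'' d (bnd d) (nest bnd d c)) (Suc (bv d) * (nest_time bv d T + icost (bnd d) + 12))
    (\<lambda>\<tau>. Inv (bv d) \<tau> \<and> imem \<tau> ''i'' d = bv d) \<sigma>"
  proof (rule wp_For)
    show "Inv 0 (iwrite ''i'' d 0 \<sigma>)" using Suc.prems stable by (auto simp: Inv_def mem_simps)
  next
    fix i \<rho> assume "Inv i \<rho>"
    then show "ival (bnd d) \<rho> = bv d" using Suc.prems by (intro bnd) (auto simp: Inv_def)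
  next
    fix i \<rho> assume i: "i < bv d" "Inv i \<rho>" "imem \<rho> ''i'' d = i"
    have lt: "imem \<rho> ''i'' j < bv j" if "d \<le> j" "j < L" for j
      using i that Suc.prems(3)[of j] by (cases "j = d") (auto simp: Inv_def)
    have "wp (nest bnd d c) (nest_time bv d T)
      (\<lambda>\<tau>. I \<tau> \<and> (\<forall>j\<ge>d. imem \<tau> ''i'' j = imem \<rho> ''i'' j) \<and> (\<forall>f. Done f \<rho> \<longrightarrow> Done f \<tau>) \<and>
      (\<forall>f. (\<forall>j<d. f j < bv j) \<and> (\<forall>j\<ge>d. f j = imem \<rho> ''i'' j) \<longrightarrow> Done f \<tau>)) \<rho>"
      by (rule Suc.IH) (use Suc.prems i lt in \<open>auto simp: Inv_def\<close>)
    then show "wp (nest bnd d c) (nest_time bv d T)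
      (\<lambda>\<tau>. imem \<tau> ''i'' d = i \<and> Inv (Suc i) (iwrite ''i'' d (Suc i) \<tau>)) \<rho>"
    proof (rule wp_mono)
      fix \<tau> assume t: "I \<tau> \<and> (\<forall>j\<ge>d. imem \<tau> ''i'' j = imem \<rho> ''i'' j) \<and> (\<forall>f. Done f \<rho> \<longrightarrow> Done f \<tau>) \<and>
        (\<forall>f. (\<forall>j<d. f j < bv j) \<and> (\<forall>j\<ge>d. f j = imem \<rho> ''i'' j) \<longrightarrow> Done f \<tau>)"
      have "Done f \<tau>" if f: "\<forall>j<d. f j < bv j" "f d < Suc i" "\<forall>j\<ge>Suc d. f j = imem \<sigma> ''i'' j" for f
      proof (cases "f d = i")
        case True
        then have "f j = imem \<rho> ''i'' j" if "j \<ge> d" for j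
          using that f(3) i(2,3) by (cases "j = d") (auto simp: Inv_def)
        then show ?thesis using t f(1) by blast
      next
        case False
        then have "Done f \<rho>" using i(2) f by (auto simp: Inv_def)
        then show ?thesis using t by blast
      qed
      moreover have "Done f \<tau>" if "Done f \<sigma>" for f using that t i(2) by (auto simp: Inv_def)
      ultimately show "imem \<tau> ''i'' d = i \<and> Inv (Suc i) (iwrite ''i'' d (Suc i) \<tau>)"
        using t i stable by (simp add: Inv_def mem_simps)
    qed simp
  qed
  then show ?case unfolding nest.simps nest_time.simps
  proof (rule wp_mono)
    fix \<tau> assume "Inv (bv d) \<tau> \<and> imem \<tau> ''i'' d = bv d"
    then show "I \<tau> \<and> (\<forall>j\<ge>Suc d. imem \<tau> ''i'' j = imem \<sigma> ''i'' j) \<and> (\<forall>f. Done f \<sigma> \<longrightarrow> Done f \<tau>) \<and>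
      (\<forall>f. (\<forall>j<Suc d. f j < bv j) \<and> (\<forall>j\<ge>Suc d. f j = imem \<sigma> ''i'' j) \<longrightarrow> Done f \<tau>)"
      unfolding Inv_def by auto
  next
    show "Suc (bv d) * (nest_time bv d T + icost (bnd d) + 12) \<le> Suc (bv d) * (nest_time bv d T + 14)"
      using bnd(2)[of d] by (intro mult_le_mono) auto
  qed
qed

section \<open>Evaluating one hyperplane tuple\<close>

text \<open>
  Component \<open>l < D\<close> is the real part of \<open>cnj (V $$ (n, l)) * cis (2 \<pi> m / M)\<close>, component \<open>D + l\<close> its
  imaginary part.
\<close>

definition point :: "nat \<Rightarrow> nat \<Rightarrow> complex mat \<Rightarrow> nat \<Rightarrow> nat \<Rightarrow> nat \<Rightarrow> real" where
  "point M D V n m l =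
    (if l < D then Re (V $$ (n, l)) * cos (2 * pi * real m / real M) +
                   Im (V $$ (n, l)) * sin (2 * pi * real m / real M)
     else Re (V $$ (n, l - D)) * sin (2 * pi * real m / real M) -
          Im (V $$ (n, l - D)) * cos (2 * pi * real m / real M))"

text \<open>The input together with tables of the symbols; the search, the counting and the listing
  leave this data intact.\<close>

definition env :: "nat \<Rightarrow> nat \<Rightarrow> nat \<Rightarrow> complex mat \<Rightarrow> memory \<Rightarrow> bool" where
  "env M D N V \<sigma> \<longleftrightarrow> imem \<sigma> ''N'' 0 = N \<and>
     (\<forall>n<N. \<forall>l<D. rmem \<sigma> ''Vre'' (n * D + l) = Re (V $$ (n, l)) \<and>
                   rmem \<sigma> ''Vim'' (n * D + l) = Im (V $$ (n, l))) \<and>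
     (\<forall>m<M. rmem \<sigma> ''ct'' m = cos (2 * pi * real m / real M) \<and>
             rmem \<sigma> ''st'' m = sin (2 * pi * real m / real M))"

lemma env_cong:
  assumes "imem \<sigma> ''N'' = imem \<tau> ''N''" "\<And>x. x \<in> {''Vre'', ''Vim'', ''ct'', ''st''} \<Longrightarrow> rmem \<sigma> x = rmem \<tau> x"
  shows "env M D N V \<sigma> = env M D N V \<tau>"
  using assms by (simp add: env_def)

lemma env_iwrite: "x \<noteq> ''N'' \<Longrightarrow> env M D N V (iwrite x k v \<sigma>) = env M D N V \<sigma>"
  by (rule env_cong) (auto simp: mem_simps)

lemma env_rwrite: "x \<notin> {''Vre'', ''Vim'', ''ct'', ''st''} \<Longrightarrow> env M D N V (rwrite x k v \<sigma>) = env M D N V \<sigma>"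
  by (rule env_cong) (auto simp: mem_simps)

text \<open>With integer constants only, \<pi> is obtained as 4 arctan 1; hence the factor
  \<open>8 * m\<close> for the angle 2 \<pi> m / M.\<close>

definition init_prog :: "nat \<Rightarrow> com" where
  "init_prog M = unroll M (\<lambda>m.
     let phi = ROp2 Divide (ROp2 Times (RConst (int (8 * m))) (ROp1 Arctan (RConst 1))) (RConst (int M)) in
     Seq (RAssign ''ct'' (IConst m) (ROp1 Cos phi)) (RAssign ''st'' (IConst m) (ROp1 Sin phi)))"

lemma loopfree_init: "loopfree (init_prog M)"
  by (simp add: init_prog_def loopfree_unroll Let_def)

lemma exec_init: "env M D N V (exec (init_prog M) (input_memory D N V))"
proof -
  let ?\<sigma> = "input_memory D N V"
  define Inv where "Inv = (\<lambda>m (\<rho> :: memory). imem \<rho> = imem ?\<sigma> \<and> (\<forall>x. x \<noteq> ''ct'' \<and> x \<noteq> ''st'' \<longrightarrow> rmem \<rho> x = rmem ?\<sigma> x) \<and>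
    (\<forall>m'<m. rmem \<rho> ''ct'' m' = cos (2 * pi * real m' / real M) \<and>
             rmem \<rho> ''st'' m' = sin (2 * pi * real m' / real M)))"
  have "Inv M (exec (init_prog M) ?\<sigma>)"
    unfolding init_prog_def
  proof (rule exec_unroll)
    show "Inv 0 ?\<sigma>" by (simp add: Inv_def)
  next
    fix m \<rho> assume "m < M" "Inv m \<rho>"
    moreover have "8 * real m * (pi / 4) = 2 * pi * real m" by simp
    ultimately show "Inv (Suc m) (exec (let phi = ROp2 Divide (ROp2 Times (RConst (int (8 * m)))
        (ROp1 Arctan (RConst 1))) (RConst (int M)) in Seq (RAssign ''ct'' (IConst m) (ROp1 Cos phi))
        (RAssign ''st'' (IConst m) (ROp1 Sin phi))) \<rho>)"
      by (simp add: Inv_def mem_simps Let_def less_Suc_eq arctan_one mult.assoc)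
  qed
  moreover have "n * D + l < N * D" if "n < N" "l < D" for n l
  proof -
    have "n * D + l < Suc n * D" using that by simp
    also have "\<dots> \<le> N * D" using that by (intro mult_le_mono1) simp
    finally show ?thesis .
  qed
  ultimately show ?thesis by (simp add: Inv_def env_def input_memory_def)
qed

definition cell :: "nat \<Rightarrow> string \<Rightarrow> iexp \<Rightarrow> nat \<Rightarrow> rexp" where
  "cell D x n l = RCell x (IAdd (IMul n (IConst D)) (IConst l))"

definition point_exp :: "nat \<Rightarrow> iexp \<Rightarrow> iexp \<Rightarrow> nat \<Rightarrow> rexp" where
  "point_exp D n m l =
    (if l < D then ROp2 Plus (ROp2 Times (cell D ''Vre'' n l) (RCell ''ct'' m))
                             (ROp2 Times (cell D ''Vim'' n l) (RCell ''st'' m))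
     else ROp2 Minus (ROp2 Times (cell D ''Vre'' n (l - D)) (RCell ''st'' m))
                     (ROp2 Times (cell D ''Vim'' n (l - D)) (RCell ''ct'' m)))"

lemma rval_point_exp:
  "env M D N V \<sigma> \<Longrightarrow> ival n \<sigma> < N \<Longrightarrow> ival m \<sigma> < M \<Longrightarrow> l < 2 * D \<Longrightarrow>
    rval (point_exp D n m l) \<sigma> = point M D V (ival n \<sigma>) (ival m \<sigma>) l"
proof (cases "l < D")
  case False
  assume "env M D N V \<sigma>" "ival n \<sigma> < N" "ival m \<sigma> < M" "l < 2 * D"
  moreover from this False obtain q where "l = D + q" "q < D"
    using less_imp_add_positive[of D] by (metis add_less_cancel_left le_Suc_ex linorder_not_less mult_2)
  ultimately show ?thesis by (simp add: env_def point_exp_def point_def cell_def)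
qed (simp add: env_def point_exp_def point_def cell_def)

definition tuple_exp :: "nat \<Rightarrow> nat \<Rightarrow> nat \<Rightarrow> nat \<Rightarrow> rexp" where
  "tuple_exp D r j l = (let L = 2 * D - 1; i = (\<lambda>q. ICell ''i'' (IConst q)) in
     if j < L then ROp2 Minus (point_exp D (i j) (i (L + j)) l) (point_exp D (i j) (i (2 * L + j)) l)
     else RConst (unit_vec_signed r l))"

definition tuple_ok :: "nat \<Rightarrow> nat \<Rightarrow> nat \<Rightarrow> (nat \<Rightarrow> nat) \<Rightarrow> bool" where
  "tuple_ok M D N f \<longleftrightarrow> (\<forall>j<2 * D - 1. f j < N) \<and> (\<forall>j<2 * (2 * D - 1). f (2 * D - 1 + j) < M)"

lemma rval_tuple_exp:
  assumes "env M D N V \<sigma>" "tuple_ok M D N (imem \<sigma> ''i'')" "l < 2 * D"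
  shows "rval (tuple_exp D r j l) \<sigma> =
    hyperplane_tuple (2 * D - 1) (point M D V) r (imem \<sigma> ''i'') j l"
proof (cases "j < 2 * D - 1")
  case True
  define L where "L = 2 * D - 1"
  let ?f = "imem \<sigma> ''i''"
  have "?f j < N" "?f (L + j) < M" "?f (L + (L + j)) < M"
    using assms(2) True unfolding tuple_ok_def L_def[symmetric] by auto
  moreover have "L + (L + j) = 2 * L + j" by simp
  moreover have "tuple_exp D r j l = ROp2 Minus
      (point_exp D (ICell ''i'' (IConst j)) (ICell ''i'' (IConst (L + j))) l)
      (point_exp D (ICell ''i'' (IConst j)) (ICell ''i'' (IConst (2 * L + j))) l)"
    using True unfolding tuple_exp_def Let_def L_def by simp
  ultimately show ?thesis
    using True assms(3) unfolding L_def[symmetric]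
    by (simp add: hyperplane_tuple_def rval_point_exp[OF assms(1)])
next
  case False
  then show ?thesis by (simp add: tuple_exp_def hyperplane_tuple_def Let_def)
qed

text \<open>The pairing function is evaluated in the program text, so a matrix access is an access
  to a constant address; its injectivity keeps the entries apart.\<close>

definition basis_cell :: "nat \<Rightarrow> nat \<Rightarrow> rexp" where
  "basis_cell j l = RCell ''c'' (IConst (prod_encode (j, l)))"

definition gs_exp :: "nat \<Rightarrow> nat \<Rightarrow> nat \<Rightarrow> nat \<Rightarrow> rexp" where
  "gs_exp D r j l = ROp2 Minus (tuple_exp D r j l) (rsum j (\<lambda>i.
     ROp2 Times (ROp2 Divide
         (rsum (2 * D) (\<lambda>l'. ROp2 Times (tuple_exp D r j l') (basis_cell i l')))
         (rsum (2 * D) (\<lambda>l'. ROp2 Times (basis_cell i l') (basis_cell i l'))))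
       (basis_cell i l)))"

definition gs_prog :: "nat \<Rightarrow> nat \<Rightarrow> com" where
  "gs_prog D r = unroll (2 * D) (\<lambda>j. unroll (2 * D) (\<lambda>l.
     RAssign ''c'' (IConst (prod_encode (j, l))) (gs_exp D r j l)))"

lemma rval_gs_exp:
  assumes "env M D N V \<sigma>" "tuple_ok M D N (imem \<sigma> ''i'')" "l < 2 * D"
    and "\<And>i l'. i < j \<Longrightarrow> l' < 2 * D \<Longrightarrow> rmem \<sigma> ''c'' (prod_encode (i, l')) =
      gs (2 * D) (hyperplane_tuple (2 * D - 1) (point M D V) r (imem \<sigma> ''i'')) i l'"
  shows "rval (gs_exp D r j l) \<sigma> =
    gs (2 * D) (hyperplane_tuple (2 * D - 1) (point M D V) r (imem \<sigma> ''i'')) j l"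
  by (subst gs_residual)
    (simp add: gs_exp_def residual_def rval_rsum ip_def basis_cell_def assms rval_tuple_exp[OF assms(1,2)])

lemma loopfree_gs: "loopfree (gs_prog D r)"
  by (simp add: gs_prog_def loopfree_unroll)

lemma exec_gs:
  fixes \<sigma> V D r M
  defines "c \<equiv> gs (2 * D) (hyperplane_tuple (2 * D - 1) (point M D V) r (imem \<sigma> ''i''))"
  assumes "env M D N V \<sigma>" "tuple_ok M D N (imem \<sigma> ''i'')"
  shows "imem (exec (gs_prog D r) \<sigma>) = imem \<sigma> \<and>
    (\<forall>x. x \<noteq> ''c'' \<longrightarrow> rmem (exec (gs_prog D r) \<sigma>) x = rmem \<sigma> x) \<and>
    (\<forall>j<2 * D. \<forall>l<2 * D. rmem (exec (gs_prog D r) \<sigma>) ''c'' (prod_encode (j, l)) = c j l)"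
proof -
  \<comment> \<open>Rows below \<open>j\<close> are complete and row \<open>j\<close> is filled up
    to \<open>l\<close>; thus \<open>Inv j (2 * D)\<close> passes into
    \<open>Inv (Suc j) 0\<close>.\<close>
  define Inv where "Inv = (\<lambda>j l (\<rho> :: memory). imem \<rho> = imem \<sigma> \<and> (\<forall>x. x \<noteq> ''c'' \<longrightarrow> rmem \<rho> x = rmem \<sigma> x) \<and>
    (\<forall>j'<j. \<forall>l<2 * D. rmem \<rho> ''c'' (prod_encode (j', l)) = c j' l) \<and>
    (\<forall>l'<l. rmem \<rho> ''c'' (prod_encode (j, l')) = c j l'))"
  have "Inv (2 * D) 0 (exec (gs_prog D r) \<sigma>)"
    unfolding gs_prog_def
  proof (rule exec_unroll[where Inv = "\<lambda>j. Inv j 0"])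
    show "Inv 0 0 \<sigma>" by (simp add: Inv_def)
  next
    fix j \<rho> assume j: "j < 2 * D" "Inv j 0 \<rho>"
    have "Inv j (2 * D) (exec (unroll (2 * D) (\<lambda>l.
        RAssign ''c'' (IConst (prod_encode (j, l))) (gs_exp D r j l))) \<rho>)"
    proof (rule exec_unroll[where Inv = "Inv j", OF j(2)])
      fix l \<phi> assume l: "l < 2 * D" "Inv j l \<phi>"
      have i: "imem \<phi> = imem \<sigma>" and r: "\<And>x. x \<noteq> ''c'' \<Longrightarrow> rmem \<phi> x = rmem \<sigma> x"
        using l by (auto simp: Inv_def)
      have "env M D N V \<phi>" using assms(2) i r by (subst env_cong[of _ \<sigma>]) auto
      moreover have "tuple_ok M D N (imem \<phi> ''i'')" using assms(3) i by simp
      ultimately have "rval (gs_exp D r j l) \<phi> = c j l"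
        unfolding c_def i[symmetric] using l
        by (intro rval_gs_exp) (auto simp: Inv_def c_def i)
      then show "Inv j (Suc l) (exec (RAssign ''c'' (IConst (prod_encode (j, l))) (gs_exp D r j l)) \<phi>)"
        using l by (auto simp: Inv_def mem_simps less_Suc_eq)
    qed
    then show "Inv (Suc j) 0 (exec (unroll (2 * D) (\<lambda>l.
        RAssign ''c'' (IConst (prod_encode (j, l))) (gs_exp D r j l))) \<rho>)"
      by (auto simp: Inv_def less_Suc_eq)
  qed
  then show ?thesis by (simp add: Inv_def)
qed

primrec lex_bexp :: "nat \<Rightarrow> iexp \<Rightarrow> iexp \<Rightarrow> iexp \<Rightarrow> nat \<Rightarrow> bexp" where
  "lex_bexp D n m s 0 = RLess (RConst 0) (RConst 0)"
| "lex_bexp D n m s (Suc j) =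
    (let e = rsum (2 * D) (\<lambda>l. ROp2 Times (ROp2 Minus (point_exp D n m l) (point_exp D n s l)) (basis_cell j l)) in
     BNot (BAnd (BNot (RLess (RConst 0) e)) (BNot (BAnd (BNot (RLess e (RConst 0))) (lex_bexp D n m s j)))))"

lemma bval_lex_bexp:
  assumes "env M D N V \<sigma>" "ival n \<sigma> < N" "ival m \<sigma> < M" "ival s \<sigma> < M"
    and "\<And>j l. j < 2 * D \<Longrightarrow> l < 2 * D \<Longrightarrow> rmem \<sigma> ''c'' (prod_encode (j, l)) = c j l"
  shows "j \<le> 2 * D \<Longrightarrow> bval (lex_bexp D n m s j) \<sigma> =
    lexpos (2 * D) c j (\<lambda>l. point M D V (ival n \<sigma>) (ival m \<sigma>) l - point M D V (ival n \<sigma>) (ival s \<sigma>) l)"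
proof (induction j)
  case (Suc j)
  then show ?case
    by (auto simp: Let_def rval_rsum ip_def basis_cell_def assms rval_point_exp[OF assms(1)])
qed simp

definition pick_prog :: "nat \<Rightarrow> nat \<Rightarrow> com" where
  "pick_prog M D = Seq (IAssign ''s'' (ICell ''n'' (IConst 0)) (IConst 0)) (unroll M (\<lambda>m.
     If (lex_bexp D (ICell ''n'' (IConst 0)) (IConst m) (ICell ''s'' (ICell ''n'' (IConst 0))) (2 * D))
        (IAssign ''s'' (ICell ''n'' (IConst 0)) (IConst m)) Skip))"

lemma loopfree_pick: "loopfree (pick_prog M D)"
  by (simp add: pick_prog_def loopfree_unroll)

lemma exec_pick:
  assumes "env M D N V \<sigma>" "imem \<sigma> ''n'' 0 = n" "n < N"
    and "\<And>j l. j < 2 * D \<Longrightarrow> l < 2 * D \<Longrightarrow> rmem \<sigma> ''c'' (prod_encode (j, l)) = c j l"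
  shows "exec (pick_prog M D) \<sigma> = iwrite ''s'' n (pick (2 * D) c (point M D V n) M) \<sigma>"
proof -
  let ?p = "pick (2 * D) c (point M D V n)"
  have ww: "iwrite ''s'' n v (iwrite ''s'' n w \<sigma>) = iwrite ''s'' n v \<sigma>" for v w
    by (simp add: iwrite_def)
  have "exec (unroll M (\<lambda>m.
     If (lex_bexp D (ICell ''n'' (IConst 0)) (IConst m) (ICell ''s'' (ICell ''n'' (IConst 0))) (2 * D))
        (IAssign ''s'' (ICell ''n'' (IConst 0)) (IConst m)) Skip)) (iwrite ''s'' n 0 \<sigma>) =
     iwrite ''s'' n (?p M) \<sigma>"
  proof (rule exec_unroll[where Inv = "\<lambda>m \<rho>. \<rho> = iwrite ''s'' n (?p m) \<sigma>"])
    fix m \<rho> assume m: "m < M" "\<rho> = iwrite ''s'' n (?p m) \<sigma>"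
    have pm: "?p m < M" using m(1) pick_less[of m "2 * D" c "point M D V n"] by (cases m) auto
    have "bval (lex_bexp D (ICell ''n'' (IConst 0)) (IConst m) (ICell ''s'' (ICell ''n'' (IConst 0))) (2 * D)) \<rho> =
      lexpos (2 * D) c (2 * D) (\<lambda>l. point M D V (ival (ICell ''n'' (IConst 0)) \<rho>) (ival (IConst m) \<rho>) l -
        point M D V (ival (ICell ''n'' (IConst 0)) \<rho>) (ival (ICell ''s'' (ICell ''n'' (IConst 0))) \<rho>) l)"
      by (rule bval_lex_bexp) (use m pm assms in \<open>auto simp: env_iwrite mem_simps\<close>)
    also have "\<dots> = lexpos (2 * D) c (2 * D) (\<lambda>l. point M D V n m l - point M D V n (?p m) l)"
      using m assms(2) by (simp add: mem_simps)
    finally show "exec (If (lex_bexp D (ICell ''n'' (IConst 0)) (IConst m) (ICell ''s'' (ICell ''n'' (IConst 0))) (2 * D))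
        (IAssign ''s'' (ICell ''n'' (IConst 0)) (IConst m)) Skip) \<rho> = iwrite ''s'' n (?p (Suc m)) \<sigma>"
      using m assms(2) by (simp add: mem_simps ww)
  qed simp
  then show ?thesis using assms(2) by (simp add: pick_prog_def)
qed

definition accumulate_prog :: "nat \<Rightarrow> nat \<Rightarrow> com" where
  "accumulate_prog M D = Seq (pick_prog M D) (unroll (2 * D) (\<lambda>l.
     RAssign ''z'' (IConst l) (ROp2 Plus (RCell ''z'' (IConst l))
       (point_exp D (ICell ''n'' (IConst 0)) (ICell ''s'' (ICell ''n'' (IConst 0))) l))))"

lemma loopfree_accumulate: "loopfree (accumulate_prog M D)"
  by (simp add: accumulate_prog_def loopfree_pick loopfree_unroll)

lemma exec_accumulate:
  assumes "env M D N V \<sigma>" "imem \<sigma> ''n'' 0 = n" "n < N" "M > 0"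
    and "\<And>j l. j < 2 * D \<Longrightarrow> l < 2 * D \<Longrightarrow> rmem \<sigma> ''c'' (prod_encode (j, l)) = c j l"
  defines "m \<equiv> pick (2 * D) c (point M D V n) M" and "\<tau> \<equiv> exec (accumulate_prog M D) \<sigma>"
  shows "imem \<tau> = (imem \<sigma>)(''s'' := (imem \<sigma> ''s'')(n := m))"
    and "\<And>x. x \<noteq> ''z'' \<Longrightarrow> rmem \<tau> x = rmem \<sigma> x"
    and "\<And>l. l < 2 * D \<Longrightarrow> rmem \<tau> ''z'' l = rmem \<sigma> ''z'' l + point M D V n m l"
proof -
  let ?b = "\<lambda>l. RAssign ''z'' (IConst l) (ROp2 Plus (RCell ''z'' (IConst l))
       (point_exp D (ICell ''n'' (IConst 0)) (ICell ''s'' (ICell ''n'' (IConst 0))) l))"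
  let ?\<sigma> = "iwrite ''s'' n m \<sigma>"
  define Inv where "Inv = (\<lambda>l (\<rho> :: memory). imem \<rho> = imem ?\<sigma> \<and> (\<forall>x. x \<noteq> ''z'' \<longrightarrow> rmem \<rho> x = rmem ?\<sigma> x) \<and>
    (\<forall>l'. rmem \<rho> ''z'' l' = (if l' < l then rmem \<sigma> ''z'' l' + point M D V n m l' else rmem \<sigma> ''z'' l')))"
  have "m < M" unfolding m_def using \<open>M > 0\<close> by (rule pick_less)
  have "Inv (2 * D) (exec (unroll (2 * D) ?b) ?\<sigma>)"
  proof (rule exec_unroll)
    show "Inv 0 ?\<sigma>" by (simp add: Inv_def mem_simps)
  next
    fix l \<rho> assume l: "l < 2 * D" "Inv l \<rho>"
    have "env M D N V \<rho>" using assms(1) l(2) by (subst env_cong[of _ \<sigma>]) (auto simp: Inv_def mem_simps)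
    then have "rval (point_exp D (ICell ''n'' (IConst 0)) (ICell ''s'' (ICell ''n'' (IConst 0))) l) \<rho> =
      point M D V (ival (ICell ''n'' (IConst 0)) \<rho>) (ival (ICell ''s'' (ICell ''n'' (IConst 0))) \<rho>) l"
      by (rule rval_point_exp) (use l assms(2,3) \<open>m < M\<close> in \<open>auto simp: Inv_def mem_simps\<close>)
    also have "\<dots> = point M D V n m l" using l assms(2) by (simp add: Inv_def mem_simps)
    finally show "Inv (Suc l) (exec (?b l) \<rho>)"
      using l by (auto simp: Inv_def mem_simps)
  qed
  then have "Inv (2 * D) \<tau>"
    unfolding \<tau>_def accumulate_prog_def exec.simps m_def using exec_pick[OF assms(1-3,5)] by simp
  then show "imem \<tau> = (imem \<sigma>)(''s'' := (imem \<sigma> ''s'')(n := m))"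
    and "\<And>x. x \<noteq> ''z'' \<Longrightarrow> rmem \<tau> x = rmem \<sigma> x"
    and "\<And>l. l < 2 * D \<Longrightarrow> rmem \<tau> ''z'' l = rmem \<sigma> ''z'' l + point M D V n m l"
    by (auto simp: Inv_def mem_simps)
qed

section \<open>Searching all tuples\<close>

definition sqnorm_exp :: "nat \<Rightarrow> rexp" where
  "sqnorm_exp D = rsum (2 * D) (\<lambda>l. ROp2 Times (RCell ''z'' (IConst l)) (RCell ''z'' (IConst l)))"

definition reset_prog :: "nat \<Rightarrow> nat \<Rightarrow> com" where
  "reset_prog D r = Seq (gs_prog D r) (unroll (2 * D) (\<lambda>l. RAssign ''z'' (IConst l) (RConst 0)))"

definition store_prog :: com where
  "store_prog = IAssign ''bs'' (ICell ''n'' (IConst 0)) (ICell ''s'' (ICell ''n'' (IConst 0)))"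

definition update_best :: "nat \<Rightarrow> com" where
  "update_best D = RAssign ''best'' (IConst 0) (sqnorm_exp D)"

text \<open>The basis is built once per tuple, and only the passes over the rows are loops; hence
  the time is linear in \<open>N\<close>.\<close>

definition candidate_prog :: "nat \<Rightarrow> nat \<Rightarrow> nat \<Rightarrow> com" where
  "candidate_prog M D r =
     Seq (reset_prog D r)
    (Seq (For ''n'' 0 (ICell ''N'' (IConst 0)) (accumulate_prog M D))
         (If (RLess (RCell ''best'' (IConst 0)) (sqnorm_exp D))
             (Seq (update_best D) (For ''n'' 0 (ICell ''N'' (IConst 0)) store_prog))
             Skip))"

definition candidate_time :: "nat \<Rightarrow> nat \<Rightarrow> nat \<Rightarrow> nat \<Rightarrow> nat" where
  "candidate_time M D N r = cost (reset_prog D r) + (Suc N * (cost (accumulate_prog M D) + 14) +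
     (1 + bcost (RLess (RCell ''best'' (IConst 0)) (sqnorm_exp D)) +
        (cost (update_best D) + Suc N * (cost store_prog + 14))))"

lemma loopfree_reset: "loopfree (reset_prog D r)"
  by (simp add: reset_prog_def loopfree_gs loopfree_unroll)

lemma exec_reset:
  fixes r :: nat
  assumes "env M D N V \<sigma>" "tuple_ok M D N (imem \<sigma> ''i'')"
  defines "\<tau> \<equiv> exec (reset_prog D r) \<sigma>"
  shows "imem \<tau> = imem \<sigma>" "\<And>x. x \<noteq> ''c'' \<Longrightarrow> x \<noteq> ''z'' \<Longrightarrow> rmem \<tau> x = rmem \<sigma> x"
    "\<And>j l. j < 2 * D \<Longrightarrow> l < 2 * D \<Longrightarrow> rmem \<tau> ''c'' (prod_encode (j, l)) =
      gs (2 * D) (hyperplane_tuple (2 * D - 1) (point M D V) r (imem \<sigma> ''i'')) j l"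
    "\<And>l. l < 2 * D \<Longrightarrow> rmem \<tau> ''z'' l = 0"
proof -
  let ?\<sigma> = "exec (gs_prog D r) \<sigma>"
  define Inv where "Inv = (\<lambda>l (\<rho> :: memory). imem \<rho> = imem ?\<sigma> \<and>
    (\<forall>x. x \<noteq> ''z'' \<longrightarrow> rmem \<rho> x = rmem ?\<sigma> x) \<and> (\<forall>l'<l. rmem \<rho> ''z'' l' = 0))"
  have "Inv (2 * D) (exec (unroll (2 * D) (\<lambda>l. RAssign ''z'' (IConst l) (RConst 0))) ?\<sigma>)"
    by (rule exec_unroll) (auto simp: Inv_def mem_simps less_Suc_eq)
  then have "Inv (2 * D) \<tau>" by (simp add: \<tau>_def reset_prog_def)
  with exec_gs[OF assms(1,2), of r]
  show "imem \<tau> = imem \<sigma>" "\<And>x. x \<noteq> ''c'' \<Longrightarrow> x \<noteq> ''z'' \<Longrightarrow> rmem \<tau> x = rmem \<sigma> x"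
    "\<And>j l. j < 2 * D \<Longrightarrow> l < 2 * D \<Longrightarrow> rmem \<tau> ''c'' (prod_encode (j, l)) =
      gs (2 * D) (hyperplane_tuple (2 * D - 1) (point M D V) r (imem \<sigma> ''i'')) j l"
    "\<And>l. l < 2 * D \<Longrightarrow> rmem \<tau> ''z'' l = 0"
    by (auto simp: Inv_def)
qed

text \<open>The search starts with \<open>best\<close> equal to -1, when \<open>''bs''\<close> means
  nothing yet. Squared norms are nonnegative, so the first candidate always replaces it.\<close>

definition best_inv :: "nat \<Rightarrow> nat \<Rightarrow> nat \<Rightarrow> complex mat \<Rightarrow> memory \<Rightarrow> bool" where
  "best_inv M D N V \<sigma> \<longleftrightarrow> env M D N V \<sigma> \<and>
     (0 \<le> rmem \<sigma> ''best'' 0 \<longrightarrow> (\<forall>n<N. imem \<sigma> ''bs'' n < M) \<and>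
        sqnorm_sum (2 * D) N (point M D V) (imem \<sigma> ''bs'') = rmem \<sigma> ''best'' 0)"

definition candidate :: "nat \<Rightarrow> nat \<Rightarrow> complex mat \<Rightarrow> nat \<Rightarrow> (nat \<Rightarrow> nat) \<Rightarrow> nat \<Rightarrow> nat" where
  "candidate M D V r f n =
     pick (2 * D) (gs (2 * D) (hyperplane_tuple (2 * D - 1) (point M D V) r f)) (point M D V n) M"

lemma sqnorm_sum_cong: "(\<And>n. n < N \<Longrightarrow> s n = s' n) \<Longrightarrow> sqnorm_sum k N p s = sqnorm_sum k N p s'"
  by (simp add: sqnorm_sum_def)

text \<open>Besides beating its own candidate, \<open>best\<close> never decreases, so comparisons
  made for earlier tuples stay valid.\<close>

lemma wp_candidate:
  assumes best: "best_inv M D N V \<sigma>" and ok: "tuple_ok M D N (imem \<sigma> ''i'')" and "M > 0"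
  shows "wp (candidate_prog M D r) (candidate_time M D N r)
    (\<lambda>\<tau>. best_inv M D N V \<tau> \<and> imem \<tau> ''i'' = imem \<sigma> ''i'' \<and>
      sqnorm_sum (2 * D) N (point M D V) (candidate M D V r (imem \<sigma> ''i'')) \<le> rmem \<tau> ''best'' 0 \<and>
      rmem \<sigma> ''best'' 0 \<le> rmem \<tau> ''best'' 0) \<sigma>"
proof -
  define k where "k = 2 * D"
  define p where "p = point M D V"
  define c where "c = gs k (hyperplane_tuple (2 * D - 1) p r (imem \<sigma> ''i''))"
  define s where "s = candidate M D V r (imem \<sigma> ''i'')"
  have s_pick: "s n = pick k c (p n) M" for n
    by (simp add: s_def candidate_def c_def k_def p_def)
  have sM: "s n < M" for n unfolding s_pick using \<open>M > 0\<close> by (rule pick_less)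
  have env: "env M D N V \<sigma>" using best by (simp add: best_inv_def)
  \<comment> \<open>The frame condition: input, tables and tuple counters survive every
    phase.\<close>
  define same where "same = (\<lambda>\<rho> :: memory. imem \<rho> ''N'' = imem \<sigma> ''N'' \<and> imem \<rho> ''i'' = imem \<sigma> ''i'' \<and>
    (\<forall>x. x \<noteq> ''c'' \<and> x \<noteq> ''z'' \<and> x \<noteq> ''best'' \<longrightarrow> rmem \<rho> x = rmem \<sigma> x))"
  have env_same: "env M D N V \<rho>" if "same \<rho>" for \<rho>
  proof -
    have "env M D N V \<rho> = env M D N V \<sigma>"
      by (rule env_cong) (use that in \<open>simp_all add: same_def, fastforce\<close>)
    with env show ?thesis by simp
  qed
  define acc where "acc = (\<lambda>n (\<rho> :: memory). same \<rho> \<and> imem \<rho> ''bs'' = imem \<sigma> ''bs'' \<and>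
    rmem \<rho> ''best'' = rmem \<sigma> ''best'' \<and>
    (\<forall>j<k. \<forall>l<k. rmem \<rho> ''c'' (prod_encode (j, l)) = c j l) \<and>
    (\<forall>n'<n. imem \<rho> ''s'' n' = s n') \<and>
    (\<forall>l<k. rmem \<rho> ''z'' l = (\<Sum>n'<n. p n' (s n') l)))"
  have reset: "wp (reset_prog D r) (cost (reset_prog D r)) (acc 0) \<sigma>"
    using exec_reset[OF env ok, where r = r]
    by (intro wp_exec loopfree_reset) (auto simp: acc_def same_def c_def k_def p_def)
  have accumulate: "wp (For ''n'' 0 (ICell ''N'' (IConst 0)) (accumulate_prog M D))
      (Suc N * (cost (accumulate_prog M D) + 14)) (acc N) \<rho>" if "acc 0 \<rho>" for \<rho>
  proof (rule wp_mono[OF wp_For[where Inv = acc and n = N]])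
    show "acc 0 (iwrite ''n'' 0 0 \<rho>)" using that by (simp add: acc_def same_def mem_simps)
  next
    fix i \<rho> assume "acc i \<rho>"
    then have "env M D N V \<rho>" by (intro env_same) (simp add: acc_def)
    then show "ival (ICell ''N'' (IConst 0)) \<rho> = N" by (simp add: env_def)
  next
    fix n \<rho> assume n: "n < N" "acc n \<rho>" "imem \<rho> ''n'' 0 = n"
    have e: "env M D N V \<rho>" using n by (intro env_same) (simp add: acc_def)
    have c: "\<And>j l. j < 2 * D \<Longrightarrow> l < 2 * D \<Longrightarrow> rmem \<rho> ''c'' (prod_encode (j, l)) = c j l"
      using n(2) by (simp add: acc_def k_def)
    note ex = exec_accumulate[OF e n(3,1) \<open>M > 0\<close> c, folded k_def p_def, folded s_pick]
    show "wp (accumulate_prog M D) (cost (accumulate_prog M D))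
      (\<lambda>\<tau>. imem \<tau> ''n'' 0 = n \<and> acc (Suc n) (iwrite ''n'' 0 (Suc n) \<tau>)) \<rho>"
      using n ex
      by (intro wp_exec loopfree_accumulate) (auto simp: acc_def same_def mem_simps less_Suc_eq)
  qed simp_all
  have update: "wp (If (RLess (RCell ''best'' (IConst 0)) (sqnorm_exp D))
             (Seq (update_best D) (For ''n'' 0 (ICell ''N'' (IConst 0)) store_prog)) Skip)
      (1 + bcost (RLess (RCell ''best'' (IConst 0)) (sqnorm_exp D)) +
        (cost (update_best D) + Suc N * (cost store_prog + 14)))
     (\<lambda>\<tau>. best_inv M D N V \<tau> \<and> imem \<tau> ''i'' = imem \<sigma> ''i'' \<and>
      sqnorm_sum k N p s \<le> rmem \<tau> ''best'' 0 \<and> rmem \<sigma> ''best'' 0 \<le> rmem \<tau> ''best'' 0) \<rho>"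
    if acc: "acc N \<rho>" for \<rho>
  proof (rule wp_If)
    have sq: "rval (sqnorm_exp D) \<rho> = sqnorm_sum k N p s"
      using acc by (simp add: sqnorm_exp_def rval_rsum acc_def sqnorm_sum_def power2_eq_square k_def)
    {
      assume "bval (RLess (RCell ''best'' (IConst 0)) (sqnorm_exp D)) \<rho>"
      then have less: "rmem \<sigma> ''best'' 0 < sqnorm_sum k N p s"
        using acc by (simp add: sq acc_def)
      define st where "st = (\<lambda>n (\<phi> :: memory). same \<phi> \<and> rmem \<phi> ''best'' 0 = sqnorm_sum k N p s \<and>
        (\<forall>n<N. imem \<phi> ''s'' n = s n) \<and> (\<forall>n'<n. imem \<phi> ''bs'' n' = s n'))"
      have "wp (update_best D) (cost (update_best D)) (st 0) \<rho>"
        using acc by (intro wp_exec) (auto simp: update_best_def st_def acc_def same_def mem_simps sq)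
      moreover have "wp (For ''n'' 0 (ICell ''N'' (IConst 0)) store_prog)
        (Suc N * (cost store_prog + 14))
        (\<lambda>\<tau>. best_inv M D N V \<tau> \<and> imem \<tau> ''i'' = imem \<sigma> ''i'' \<and>
          sqnorm_sum k N p s \<le> rmem \<tau> ''best'' 0 \<and> rmem \<sigma> ''best'' 0 \<le> rmem \<tau> ''best'' 0) \<phi>"
        if "st 0 \<phi>" for \<phi>
      proof (rule wp_mono[OF wp_For[where Inv = st and n = N]])
        show "st 0 (iwrite ''n'' 0 0 \<phi>)" using that by (simp add: st_def same_def mem_simps)
      next
        fix i \<rho> assume "st i \<rho>"
        then have "env M D N V \<rho>" by (intro env_same) (simp add: st_def)
        then show "ival (ICell ''N'' (IConst 0)) \<rho> = N" by (simp add: env_def)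
      next
        fix n \<rho> assume "n < N" "st n \<rho>" "imem \<rho> ''n'' 0 = n"
        then show "wp store_prog (cost store_prog)
            (\<lambda>\<tau>. imem \<tau> ''n'' 0 = n \<and> st (Suc n) (iwrite ''n'' 0 (Suc n) \<tau>)) \<rho>"
          by (intro wp_exec) (auto simp: store_prog_def st_def same_def mem_simps less_Suc_eq)
      next
        fix \<tau> assume "st N \<tau> \<and> imem \<tau> ''n'' 0 = N"
        then have t: "same \<tau>" "rmem \<tau> ''best'' 0 = sqnorm_sum k N p s" "\<And>n. n < N \<Longrightarrow> imem \<tau> ''bs'' n = s n"
          by (auto simp: st_def)
        then have "sqnorm_sum k N p (imem \<tau> ''bs'') = sqnorm_sum k N p s"
          by (intro sqnorm_sum_cong) simp
        then show "best_inv M D N V \<tau> \<and> imem \<tau> ''i'' = imem \<sigma> ''i'' \<and>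
          sqnorm_sum k N p s \<le> rmem \<tau> ''best'' 0 \<and> rmem \<sigma> ''best'' 0 \<le> rmem \<tau> ''best'' 0"
          using t less sM env_same[OF t(1)]
          by (simp add: best_inv_def k_def p_def) (simp add: same_def)
      qed simp
      ultimately show "wp (Seq (update_best D) (For ''n'' 0 (ICell ''N'' (IConst 0)) store_prog))
        (cost (update_best D) + Suc N * (cost store_prog + 14))
        (\<lambda>\<tau>. best_inv M D N V \<tau> \<and> imem \<tau> ''i'' = imem \<sigma> ''i'' \<and>
          sqnorm_sum k N p s \<le> rmem \<tau> ''best'' 0 \<and> rmem \<sigma> ''best'' 0 \<le> rmem \<tau> ''best'' 0) \<rho>"
        by (rule wp_Seq)
    }
    assume "\<not> bval (RLess (RCell ''best'' (IConst 0)) (sqnorm_exp D)) \<rho>"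
    then have "sqnorm_sum k N p s \<le> rmem \<sigma> ''best'' 0" using acc by (simp add: sq acc_def)
    moreover have "env M D N V \<rho>" by (rule env_same) (use acc in \<open>simp add: acc_def\<close>)
    ultimately show "wp Skip
        (cost (update_best D) + Suc N * (cost store_prog + 14))
        (\<lambda>\<tau>. best_inv M D N V \<tau> \<and> imem \<tau> ''i'' = imem \<sigma> ''i'' \<and>
          sqnorm_sum k N p s \<le> rmem \<tau> ''best'' 0 \<and> rmem \<sigma> ''best'' 0 \<le> rmem \<tau> ''best'' 0) \<rho>"
      using best acc
      by (intro wp_mono[OF wp_exec[of Skip "\<lambda>\<tau>. \<tau> = \<rho>"]]) (auto simp: best_inv_def acc_def same_def)
  qed
  show ?thesis
    unfolding candidate_prog_def candidate_time_def s_def[symmetric] k_def[symmetric] p_def[symmetric]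
    by (rule wp_Seq[OF reset wp_Seq[OF accumulate update]])
qed

text \<open>Of the \<open>3 * L\<close> counters only the \<open>L\<close> row indices range up to
  \<open>N\<close>; the symbol indices range up to the constant \<open>M\<close>. This gives the
  exponent \<open>L\<close> in the number of tuples.\<close>

definition loop_bound :: "nat \<Rightarrow> nat \<Rightarrow> nat \<Rightarrow> iexp" where
  "loop_bound M L d = (if d < L then ICell ''N'' (IConst 0) else IConst M)"

definition search_prog :: "nat \<Rightarrow> nat \<Rightarrow> com" where
  "search_prog M D = Seq (init_prog M) (Seq (RAssign ''best'' (IConst 0) (RConst (- 1)))
     (nest (loop_bound M (2 * D - 1)) (3 * (2 * D - 1)) (unroll (2 * (2 * D)) (candidate_prog M D))))"

definition search_time :: "nat \<Rightarrow> nat \<Rightarrow> nat \<Rightarrow> nat" where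
  "search_time M D N = cost (init_prog M) + (4 +
     nest_time (\<lambda>d. if d < 2 * D - 1 then N else M) (3 * (2 * D - 1))
       (1 + (\<Sum>r<2 * (2 * D). candidate_time M D N r)))"

text \<open>Only values below \<open>N\<close> matter, so it suffices to maximize over the finite
  set of extensional functions.\<close>

lemma maximizer_exists:
  assumes "M > 0"
  shows "\<exists>s. (\<forall>n<N. s n < M) \<and>
    (\<forall>s'. (\<forall>n<N. s' n < M) \<longrightarrow> sqnorm_sum k N p s' \<le> sqnorm_sum k N p s)"
proof -
  let ?P = "{..<N} \<rightarrow>\<^sub>E {..<M}"
  have "finite ?P" by (simp add: finite_PiE)
  moreover have "?P \<noteq> {}" using assms by (auto simp: PiE_eq_empty_iff)
  ultimately have "Max (sqnorm_sum k N p ` ?P) \<in> sqnorm_sum k N p ` ?P"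
    by (intro Max_in) simp_all
  then obtain s where "s \<in> ?P" "sqnorm_sum k N p s = Max (sqnorm_sum k N p ` ?P)" by auto
  with \<open>finite ?P\<close> have "\<exists>s\<in>?P. \<forall>s'\<in>?P. sqnorm_sum k N p s' \<le> sqnorm_sum k N p s"
    by (intro bexI[of _ s]) simp_all
  then obtain s where s: "s \<in> ?P" "\<And>s'. s' \<in> ?P \<Longrightarrow> sqnorm_sum k N p s' \<le> sqnorm_sum k N p s" by blast
  have "sqnorm_sum k N p s' \<le> sqnorm_sum k N p s" if "\<forall>n<N. s' n < M" for s'
  proof -
    have "sqnorm_sum k N p s' = sqnorm_sum k N p (restrict s' {..<N})"
      by (rule sqnorm_sum_cong) simp
    also have "\<dots> \<le> sqnorm_sum k N p s" by (rule s(2)) (use that in auto)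
    finally show ?thesis .
  qed
  then show ?thesis using s(1) by (intro exI[of _ s]) (auto simp: PiE_iff)
qed

lemma wp_search:
  assumes "M > 0" "D > 0" "N > 0"
  shows "wp (search_prog M D) (search_time M D N)
    (\<lambda>\<tau>. env M D N V \<tau> \<and> (\<forall>n<N. imem \<tau> ''bs'' n < M) \<and>
      (\<forall>s. (\<forall>n<N. s n < M) \<longrightarrow> sqnorm_sum (2 * D) N (point M D V) s \<le>
         sqnorm_sum (2 * D) N (point M D V) (imem \<tau> ''bs''))) (input_memory D N V)"
proof -
  let ?p = "point M D V" and ?I = "best_inv M D N V"
  let ?b = "unroll (2 * (2 * D)) (candidate_prog M D)"
  let ?L = "2 * D - 1"
  define bv where "bv = (\<lambda>d. if d < ?L then N else M)"
  define Done where "Done = (\<lambda>f (\<tau> :: memory). \<forall>r<2 * (2 * D).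
    sqnorm_sum (2 * D) N ?p (candidate M D V r f) \<le> rmem \<tau> ''best'' 0)"
  let ?T = "1 + (\<Sum>r<2 * (2 * D). candidate_time M D N r)"
  have stable: "?I (iwrite ''i'' k v \<rho>) = ?I \<rho>" "Done f (iwrite ''i'' k v \<rho>) = Done f \<rho>" for k v \<rho> f
    by (simp_all add: best_inv_def env_iwrite mem_simps Done_def)
  have body: "wp ?b ?T (\<lambda>\<tau>. ?I \<tau> \<and> imem \<tau> ''i'' = imem \<rho> ''i'' \<and> Done (imem \<rho> ''i'') \<tau> \<and>
      (\<forall>f. Done f \<rho> \<longrightarrow> Done f \<tau>)) \<rho>"
    if "?I \<rho>" and lt: "\<And>j. j < 3 * ?L \<Longrightarrow> imem \<rho> ''i'' j < bv j" for \<rho>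
  proof -
    have ok: "tuple_ok M D N (imem \<rho> ''i'')"
      unfolding tuple_ok_def
    proof (intro conjI allI impI)
      fix j assume "j < ?L"
      then show "imem \<rho> ''i'' j < N" using lt[of j] by (simp add: bv_def)
    next
      fix j assume "j < 2 * ?L"
      moreover have "bv (?L + j) = M" by (simp only: bv_def not_add_less1 if_False)
      ultimately show "imem \<rho> ''i'' (?L + j) < M" using lt[of "?L + j"] by linarith
    qed
    define Inv where "Inv = (\<lambda>r (\<tau> :: memory). ?I \<tau> \<and> imem \<tau> ''i'' = imem \<rho> ''i'' \<and>
      (\<forall>r'<r. sqnorm_sum (2 * D) N ?p (candidate M D V r' (imem \<rho> ''i'')) \<le> rmem \<tau> ''best'' 0) \<and>
      rmem \<rho> ''best'' 0 \<le> rmem \<tau> ''best'' 0)"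
    have "wp ?b ?T (Inv (2 * (2 * D))) \<rho>"
    proof (rule wp_unroll)
      show "Inv 0 \<rho>" using that by (simp add: Inv_def)
    next
      fix r \<phi> assume r: "Inv r \<phi>"
      then have "?I \<phi>" "tuple_ok M D N (imem \<phi> ''i'')" using ok by (auto simp: Inv_def)
      from wp_candidate[OF this \<open>M > 0\<close>, of r]
      show "wp (candidate_prog M D r) (candidate_time M D N r) (Inv (Suc r)) \<phi>"
        by (rule wp_mono) (use r in \<open>auto simp: Inv_def less_Suc_eq intro: order_trans\<close>)
    qed
    then show ?thesis
      by (rule wp_mono) (auto simp: Inv_def Done_def intro: order_trans)
  qed
  have bound: "ival (loop_bound M ?L d) \<rho> = bv d" if "?I \<rho>" for d \<rho>
    using that by (simp add: loop_bound_def bv_def best_inv_def env_def)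
  have nest: "wp (nest (loop_bound M ?L) (3 * ?L) ?b) (nest_time bv (3 * ?L) ?T)
    (\<lambda>\<tau>. ?I \<tau> \<and> (\<forall>j\<ge>3 * ?L. imem \<tau> ''i'' j = imem \<sigma> ''i'' j) \<and> (\<forall>f. Done f \<sigma> \<longrightarrow> Done f \<tau>) \<and>
      (\<forall>f. (\<forall>j<3 * ?L. f j < bv j) \<and> (\<forall>j\<ge>3 * ?L. f j = imem \<sigma> ''i'' j) \<longrightarrow> Done f \<tau>)) \<sigma>"
    if "?I \<sigma>" for \<sigma>
    by (rule wp_nest[where L = "3 * ?L"]) (use that body bound stable in \<open>auto simp: loop_bound_def\<close>)
  have "wp (init_prog M) (cost (init_prog M)) (env M D N V) (input_memory D N V)"
    by (intro wp_exec loopfree_init exec_init)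
  moreover have "wp (RAssign ''best'' (IConst 0) (RConst (- 1))) 4 ?I \<rho>" if "env M D N V \<rho>" for \<rho>
    using that by (intro wp_mono[OF wp_exec[where Q = ?I]]) (simp_all add: best_inv_def env_rwrite mem_simps)
  moreover have "wp (nest (loop_bound M ?L) (3 * ?L) ?b) (nest_time bv (3 * ?L) ?T)
    (\<lambda>\<tau>. env M D N V \<tau> \<and> (\<forall>n<N. imem \<tau> ''bs'' n < M) \<and>
      (\<forall>s. (\<forall>n<N. s n < M) \<longrightarrow> sqnorm_sum (2 * D) N ?p s \<le>
         sqnorm_sum (2 * D) N ?p (imem \<tau> ''bs''))) \<sigma>" if "?I \<sigma>" for \<sigma>
  proof (rule wp_mono[OF nest[OF that]])
    fix \<tau> assume t: "?I \<tau> \<and> (\<forall>j\<ge>3 * ?L. imem \<tau> ''i'' j = imem \<sigma> ''i'' j) \<and> (\<forall>f. Done f \<sigma> \<longrightarrow> Done f \<tau>) \<and>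
      (\<forall>f. (\<forall>j<3 * ?L. f j < bv j) \<and> (\<forall>j\<ge>3 * ?L. f j = imem \<sigma> ''i'' j) \<longrightarrow> Done f \<tau>)"
    obtain s where s: "\<And>n. n < N \<Longrightarrow> s n < M"
      "\<And>s'. (\<forall>n<N. s' n < M) \<Longrightarrow> sqnorm_sum (2 * D) N ?p s' \<le> sqnorm_sum (2 * D) N ?p s"
      using maximizer_exists[OF \<open>M > 0\<close>] by metis
    have S: "Suc ?L = 2 * D" using \<open>D > 0\<close> by simp
    obtain f r where f: "\<And>j. j < ?L \<Longrightarrow> f j < N" "\<And>j. j < 2 * ?L \<Longrightarrow> f (?L + j) < M"
      and r: "r < 2 * (2 * D)"
      and max: "sqnorm_sum (2 * D) N ?p (candidate M D V r f) = sqnorm_sum (2 * D) N ?p s"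
      using tuple_finds_maximizer[of N M ?L ?p s, unfolded S, OF s(2,1) \<open>N > 0\<close> \<open>M > 0\<close>]
      unfolding candidate_def by auto
    \<comment> \<open>Beyond the counters in use, \<open>g\<close> has to agree with the initial
      memory, as \<open>wp_nest\<close> demands; a candidate reads only the first
      \<open>3 * ?L\<close> entries.\<close>
    define g where "g = (\<lambda>j. if j < 3 * ?L then f j else imem \<sigma> ''i'' j)"
    have "hyperplane_tuple ?L ?p r g = hyperplane_tuple ?L ?p r f"
      by (auto simp: hyperplane_tuple_def g_def fun_eq_iff)
    then have "candidate M D V r g = candidate M D V r f" by (intro ext) (simp add: candidate_def)
    moreover have "g j < bv j" if "j < 3 * ?L" for j
    proof (cases "j < ?L")
      case True
      then show ?thesis using f(1) by (simp add: g_def bv_def)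
    next
      case False
      then have "f (?L + (j - ?L)) < M" using that by (intro f(2)) auto
      then show ?thesis using False that by (simp add: g_def bv_def)
    qed
    ultimately have le: "sqnorm_sum (2 * D) N ?p s \<le> rmem \<tau> ''best'' 0"
      using t r max unfolding Done_def by (metis (no_types, lifting) g_def linorder_not_less)
    \<comment> \<open>So \<open>best\<close> is nonnegative, which activates the conditional part of
      \<open>best_inv\<close>: \<open>''bs''\<close> attains \<open>best\<close> and is a
      maximizer.\<close>
    moreover have "0 \<le> sqnorm_sum (2 * D) N ?p s" by (simp add: sqnorm_sum_def sum_nonneg)
    ultimately show "env M D N V \<tau> \<and> (\<forall>n<N. imem \<tau> ''bs'' n < M) \<and>
      (\<forall>s. (\<forall>n<N. s n < M) \<longrightarrow> sqnorm_sum (2 * D) N ?p s \<le> sqnorm_sum (2 * D) N ?p (imem \<tau> ''bs''))"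
      using t s(2) by (auto simp: best_inv_def intro: order_trans)
  qed simp
  ultimately show ?thesis
    unfolding search_prog_def search_time_def bv_def by (intro wp_Seq)
qed

section \<open>Counting and listing\<close>

text \<open>After shifting \<open>d\<close> by one, trinomial revision separates each term into
  \<open>N choose (2 * d + 1 - i)\<close> and this factor, which is free of \<open>N\<close> and can
  be a constant of the program.\<close>

definition coefficient :: "nat \<Rightarrow> nat \<Rightarrow> nat \<Rightarrow> nat" where
  "coefficient M d i = ((2 * d + 1 - i) choose i) * (M div 2) ^ (2 * (d - i)) * (M div 2 - 1) ^ i"

text \<open>Trinomial revision; outside the range \<open>i + k \<le> n\<close> both sides are
  0.\<close>

lemma choose_product: "(n choose i) * (n - i choose k) = (n choose (i + k)) * (i + k choose i)"
proof (cases "i + k \<le> n")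
  case True
  then show ?thesis using choose_mult[of i "i + k" n] by simp
next
  case False
  then show ?thesis by (cases "i \<le> n") (auto simp: binomial_eq_0)
qed

lemma num_candidates_binomials:
  "num_candidates M D N = (\<Sum>d<D. \<Sum>i<Suc d. (N choose (2 * d + 1 - i)) * coefficient M d i)"
proof -
  have "num_candidates M D N = (\<Sum>d<D. \<Sum>i<Suc d. (N choose i) * ((N - i) choose (2 * (Suc d - i) - 1)) *
        (M div 2) ^ (2 * (Suc d - i) - 2) * (M div 2 - 1) ^ i)"
    unfolding num_candidates_def
    by (simp add: sum.atLeast1_atMost_eq atLeast0LessThan del: sum.lessThan_Suc)
  also have "\<dots> = (\<Sum>d<D. \<Sum>i<Suc d. (N choose (2 * d + 1 - i)) * coefficient M d i)"
  proof (intro sum.cong refl)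
    fix d i assume "i \<in> {..<Suc d}"
    then have "2 * (Suc d - i) - 1 = 2 * (d - i) + 1" "2 * (Suc d - i) - 2 = 2 * (d - i)"
      "i + (2 * (d - i) + 1) = 2 * d + 1 - i" by auto
    then show "(N choose i) * ((N - i) choose (2 * (Suc d - i) - 1)) *
        (M div 2) ^ (2 * (Suc d - i) - 2) * (M div 2 - 1) ^ i = (N choose (2 * d + 1 - i)) * coefficient M d i"
      using choose_product[of N i "2 * (d - i) + 1"] by (simp add: coefficient_def)
  qed
  finally show ?thesis .
qed

text \<open>With \<open>m = M div 2\<close>, the term for \<open>(d, i)\<close> is at most the term
  for \<open>(i, k)\<close>, \<open>k = 2 * (d - i) - 1\<close>, in the trinomial expansion of
  \<open>((m - 1) + m + 1) ^ N\<close>: its power of \<open>m\<close> has exponent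
  \<open>k - 1\<close> instead of \<open>k\<close>.\<close>

lemma num_candidates_le_power:
  assumes "even M" "M > 0"
  shows "num_candidates M D N \<le> M ^ N"
proof -
  define m where "m = M div 2"
  have M: "M = (m - 1) + (m + 1)" and "m > 0" using assms by (auto simp: m_def elim: evenE)
  define S where "S = (SIGMA d:{1..D}. {0..<d})"
  define g where "g = (\<lambda>(d, i). (N choose i) * ((N - i) choose (2 * (d - i) - 1)) *
        m ^ (2 * (d - i) - 2) * (m - 1) ^ i)"
  define h where "h = (\<lambda>(i, k). (N choose i) * (m - 1) ^ i * (((N - i) choose k) * m ^ k))"
  have "num_candidates M D N = sum g S"
    unfolding num_candidates_def S_def by (subst sum.Sigma) (auto simp: g_def m_def)
  \<comment> \<open>In a nonzero term both binomials are nonzero, which confines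
    \<open>(i, k)\<close> to the index range of the expansion.\<close>
  also have "\<dots> = sum g {x \<in> S. g x \<noteq> 0}"
    by (rule sum.mono_neutral_right) (auto simp: S_def)
  also have "\<dots> \<le> sum h (SIGMA i:{..N}. {..N - i})"
  \<comment> \<open>The map recovers \<open>(d, i)\<close> from \<open>(i, k)\<close>, so different
    terms use different parts of the expansion.\<close>
  proof (rule sum_le_included[where i = "\<lambda>(i, k). (i + (k + 1) div 2, i)"])
    show "\<forall>x\<in>{x \<in> S. g x \<noteq> 0}. \<exists>y\<in>SIGMA i:{..N}. {..N - i}.
        (case y of (i, k) \<Rightarrow> (i + (k + 1) div 2, i)) = x \<and> g x \<le> h y"
    proof
      fix x assume "x \<in> {x \<in> S. g x \<noteq> 0}"
      then obtain d i where x: "x = (d, i)" and d: "i < d" "0 < g (d, i)" by (auto simp: S_def)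
      let ?k = "2 * (d - i) - 1"
      have "i \<le> N" "?k \<le> N - i"
        using d(2) by (auto simp: g_def zero_less_binomial_iff intro: ccontr)
      moreover have "i + (?k + 1) div 2 = d" using d(1) by simp
      moreover have "g (d, i) \<le> h (i, ?k)"
      proof -
        have "m ^ (2 * (d - i) - 2) \<le> m ^ ?k" using \<open>m > 0\<close> by (intro power_increasing) auto
        then show ?thesis by (simp add: g_def h_def mult.assoc mult.left_commute)
      qed
      ultimately show "\<exists>y\<in>SIGMA i:{..N}. {..N - i}.
          (case y of (i, k) \<Rightarrow> (i + (k + 1) div 2, i)) = x \<and> g x \<le> h y"
        unfolding x by (intro bexI[of _ "(i, ?k)"]) auto
    qed
  qed (auto simp: S_def)
  also have "\<dots> = (\<Sum>i\<le>N. (N choose i) * (m - 1) ^ i * (\<Sum>k\<le>N - i. ((N - i) choose k) * m ^ k))"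
  proof -
    have "(\<Sum>i\<le>N. \<Sum>k\<le>N - i. h (i, k)) = sum h (SIGMA i:{..N}. {..N - i})"
      by (subst sum.Sigma) auto
    then show ?thesis by (simp add: h_def sum_distrib_left)
  qed
  also have "\<dots> = (\<Sum>i\<le>N. (N choose i) * (m - 1) ^ i * (m + 1) ^ (N - i))"
    by (intro sum.cong refl arg_cong2[where f = "(*)"]) (simp add: binomial[of m 1, simplified])
  also have "\<dots> = ((m - 1) + (m + 1)) ^ N" by (subst binomial) simp
  finally show ?thesis using M by simp
qed

text \<open>Going from index \<open>2 * D\<close> down to 1, each cell is rewritten while its left
  neighbour still holds the old row, so one array suffices. Repeating this \<open>N\<close> times
  gives the binomials in linear time without division.\<close>

definition pascal_step :: "nat \<Rightarrow> com" where
  "pascal_step D = unroll (2 * D) (\<lambda>i. IAssign ''C'' (IConst (2 * D - i))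
     (IAdd (ICell ''C'' (IConst (2 * D - i))) (ICell ''C'' (IConst (2 * D - i - 1)))))"

definition pascal_init :: "nat \<Rightarrow> com" where
  "pascal_init D = unroll (Suc (2 * D)) (\<lambda>j. IAssign ''C'' (IConst j) (IConst (0 choose j)))"

definition total_prog :: "nat \<Rightarrow> nat \<Rightarrow> com" where
  "total_prog M D = IAssign ''K'' (IConst 0) (isum D (\<lambda>d. isum (Suc d) (\<lambda>i.
     IMul (ICell ''C'' (IConst (2 * d + 1 - i))) (IConst (coefficient M d i)))))"

definition count_prog :: "nat \<Rightarrow> nat \<Rightarrow> com" where
  "count_prog M D = Seq (pascal_init D) (Seq
     (For ''n'' 0 (ICell ''N'' (IConst 0)) (pascal_step D)) (total_prog M D))"

definition count_time :: "nat \<Rightarrow> nat \<Rightarrow> nat \<Rightarrow> nat" where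
  "count_time M D N = cost (pascal_init D) + (Suc N * (cost (pascal_step D) + 14) + cost (total_prog M D))"

lemma exec_pascal_step:
  assumes "\<And>j. j \<le> 2 * D \<Longrightarrow> imem \<sigma> ''C'' j = t choose j"
  defines "\<tau> \<equiv> exec (pascal_step D) \<sigma>"
  shows "rmem \<tau> = rmem \<sigma>" "\<And>x. x \<noteq> ''C'' \<Longrightarrow> imem \<tau> x = imem \<sigma> x"
    "\<And>j. j \<le> 2 * D \<Longrightarrow> imem \<tau> ''C'' j = Suc t choose j"
proof -
  \<comment> \<open>Entries above \<open>2 * D - i\<close> belong to the new row. Cell 0 is never
    rewritten, as it is 1 in every row.\<close>
  define Inv where "Inv = (\<lambda>i (\<rho> :: memory). rmem \<rho> = rmem \<sigma> \<and> (\<forall>x. x \<noteq> ''C'' \<longrightarrow> imem \<rho> x = imem \<sigma> x) \<and>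
    (\<forall>j\<le>2 * D. imem \<rho> ''C'' j = (if j > 2 * D - i then Suc t else t) choose j))"
  have "Inv (2 * D) \<tau>"
    unfolding \<tau>_def pascal_step_def
  proof (rule exec_unroll)
    show "Inv 0 \<sigma>" using assms(1) by (simp add: Inv_def)
  next
    fix i \<rho> assume i: "i < 2 * D" "Inv i \<rho>"
    then obtain q where q: "2 * D - i = Suc q" by (metis Suc_diff_Suc)
    then have "2 * D - Suc i = q" by simp
    with i q show "Inv (Suc i) (exec (IAssign ''C'' (IConst (2 * D - i))
     (IAdd (ICell ''C'' (IConst (2 * D - i))) (ICell ''C'' (IConst (2 * D - i - 1))))) \<rho>)"
      by (auto simp: Inv_def mem_simps)
  qed
  then show "rmem \<tau> = rmem \<sigma>" "\<And>x. x \<noteq> ''C'' \<Longrightarrow> imem \<tau> x = imem \<sigma> x"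
    "\<And>j. j \<le> 2 * D \<Longrightarrow> imem \<tau> ''C'' j = Suc t choose j"
    by (auto simp: Inv_def split: if_splits)
qed

lemma wp_count:
  assumes "imem \<sigma> ''N'' 0 = N"
  shows "wp (count_prog M D) (count_time M D N)
    (\<lambda>\<tau>. rmem \<tau> = rmem \<sigma> \<and> imem \<tau> ''N'' = imem \<sigma> ''N'' \<and> imem \<tau> ''bs'' = imem \<sigma> ''bs'' \<and>
      imem \<tau> ''K'' 0 = num_candidates M D N) \<sigma>"
proof -
  define Inv where "Inv = (\<lambda>t (\<rho> :: memory). rmem \<rho> = rmem \<sigma> \<and> imem \<rho> ''N'' = imem \<sigma> ''N'' \<and>
    imem \<rho> ''bs'' = imem \<sigma> ''bs'' \<and> (\<forall>j\<le>2 * D. imem \<rho> ''C'' j = t choose j))"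
  have init: "wp (pascal_init D) (cost (pascal_init D)) (Inv 0) \<sigma>"
  proof (rule wp_exec)
    show "loopfree (pascal_init D)" by (simp add: pascal_init_def loopfree_unroll del: unroll.simps)
    define I where "I = (\<lambda>j (\<rho> :: memory). rmem \<rho> = rmem \<sigma> \<and> imem \<rho> ''N'' = imem \<sigma> ''N'' \<and>
      imem \<rho> ''bs'' = imem \<sigma> ''bs'' \<and> (\<forall>j'<j. imem \<rho> ''C'' j' = 0 choose j'))"
    have "I (Suc (2 * D)) (exec (pascal_init D) \<sigma>)"
      unfolding pascal_init_def by (rule exec_unroll) (auto simp: I_def mem_simps less_Suc_eq)
    then show "Inv 0 (exec (pascal_init D) \<sigma>)" by (simp add: I_def Inv_def)
  qed
  have steps: "wp (For ''n'' 0 (ICell ''N'' (IConst 0)) (pascal_step D))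
      (Suc N * (cost (pascal_step D) + 14)) (Inv N) \<rho>" if "Inv 0 \<rho>" for \<rho>
  proof (rule wp_mono[OF wp_For[where Inv = Inv and n = N]])
    show "Inv 0 (iwrite ''n'' 0 0 \<rho>)" using that by (simp add: Inv_def mem_simps)
  next
    fix t \<phi> assume t: "Inv t \<phi>" "imem \<phi> ''n'' 0 = t"
    then have "\<And>j. j \<le> 2 * D \<Longrightarrow> imem \<phi> ''C'' j = t choose j" by (simp add: Inv_def)
    note ex = exec_pascal_step[OF this]
    show "wp (pascal_step D) (cost (pascal_step D))
        (\<lambda>\<tau>. imem \<tau> ''n'' 0 = t \<and> Inv (Suc t) (iwrite ''n'' 0 (Suc t) \<tau>)) \<phi>"
    proof (rule wp_exec)
      show "loopfree (pascal_step D)" by (simp add: pascal_step_def loopfree_unroll)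
    qed (use ex t in \<open>simp add: Inv_def mem_simps\<close>)
  qed (use assms in \<open>simp_all add: Inv_def\<close>)
  have total: "wp (total_prog M D) (cost (total_prog M D))
    (\<lambda>\<tau>. rmem \<tau> = rmem \<sigma> \<and> imem \<tau> ''N'' = imem \<sigma> ''N'' \<and> imem \<tau> ''bs'' = imem \<sigma> ''bs'' \<and>
      imem \<tau> ''K'' 0 = num_candidates M D N) \<rho>" if "Inv N \<rho>" for \<rho>
  proof (rule wp_exec)
    show "loopfree (total_prog M D)" by (simp add: total_prog_def)
    have "(\<Sum>d<D. \<Sum>i<Suc d. imem \<rho> ''C'' (2 * d + 1 - i) * coefficient M d i) = num_candidates M D N"
      unfolding num_candidates_binomials
      using that by (intro sum.cong refl) (simp add: Inv_def)
    then show "rmem (exec (total_prog M D) \<rho>) = rmem \<sigma> \<and> imem (exec (total_prog M D) \<rho>) ''N'' = imem \<sigma> ''N'' \<and>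
      imem (exec (total_prog M D) \<rho>) ''bs'' = imem \<sigma> ''bs'' \<and>
      imem (exec (total_prog M D) \<rho>) ''K'' 0 = num_candidates M D N"
      using that by (simp add: total_prog_def Inv_def mem_simps ival_isum del: isum.simps sum.lessThan_Suc)
  qed
  show ?thesis
    unfolding count_prog_def count_time_def by (rule wp_Seq[OF init wp_Seq[OF steps total]])
qed

section \<open>Base \<open>M\<close> counting and the output list\<close>

definition digit :: "nat \<Rightarrow> nat \<Rightarrow> nat \<Rightarrow> nat" where
  "digit M w n = w div M ^ n mod M"

text \<open>A carry enters position \<open>n\<close> exactly if all lower digits of \<open>w\<close>
  are \<open>M - 1\<close>, which is the divisibility of \<open>Suc w\<close> by
  \<open>M ^ n\<close>.\<close>

lemma digit_Suc:
  "digit M (Suc w) n =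
    (if M ^ n dvd Suc w then if Suc (digit M w n) = M then 0 else Suc (digit M w n) else digit M w n)"
proof (cases "M ^ n dvd Suc w")
  case True
  then have "Suc w div M ^ n = Suc (w div M ^ n)" by (simp add: div_Suc dvd_eq_mod_eq_0)
  then show ?thesis using True by (simp add: digit_def mod_Suc)
next
  case False
  then have "Suc w div M ^ n = w div M ^ n" by (simp add: div_Suc dvd_eq_mod_eq_0)
  then show ?thesis using False by (simp add: digit_def)
qed

text \<open>Carry propagation: a carry leaves position \<open>n\<close> if and only if one enters
  and the digit there is maximal.\<close>

lemma power_Suc_dvd_Suc:
  assumes "M > 0"
  shows "M ^ Suc n dvd Suc w \<longleftrightarrow> M ^ n dvd Suc w \<and> Suc (digit M w n) = M"
proof (cases "M ^ n dvd Suc w")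
  case True
  then have "Suc w div M ^ n = Suc (w div M ^ n)" by (simp add: div_Suc dvd_eq_mod_eq_0)
  with True have "Suc w = M ^ n * Suc (w div M ^ n)" by (metis dvd_mult_div_cancel)
  then have "M ^ Suc n dvd Suc w \<longleftrightarrow> M ^ n * M dvd M ^ n * Suc (w div M ^ n)"
    by (simp add: mult.commute)
  also have "\<dots> \<longleftrightarrow> M dvd Suc (w div M ^ n)"
    using assms by (intro nat_mult_dvd_cancel1) simp
  also have "\<dots> \<longleftrightarrow> Suc (digit M w n) = M"
    by (simp add: digit_def dvd_eq_mod_eq_0 mod_Suc)
  finally show ?thesis using True by simp
next
  case False
  then show ?thesis using dvd_trans[of "M ^ n" "M ^ Suc n" "Suc w"] by auto
qed

lemma digits_exist:
  assumes "M > 0" "\<And>n. n < N \<Longrightarrow> s n < M"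
  shows "\<exists>w. w < M ^ N \<and> (\<forall>n<N. digit M w n = s n)"
  using assms(2)
proof (induction N)
  case (Suc N)
  then obtain w where w: "w < M ^ N" "\<And>n. n < N \<Longrightarrow> digit M w n = s n" by force
  let ?w = "w + M ^ N * s N"
  have "?w < M ^ N * Suc (s N)" using w(1) by simp
  also have "\<dots> \<le> M ^ N * M" using Suc.prems[of N] by (intro mult_le_mono2) simp
  finally have "?w < M ^ Suc N" by (simp add: mult.commute)
  moreover have "digit M ?w n = s n" if "n < Suc N" for n
  proof (cases "n = N")
    case True
    then show ?thesis using w(1) Suc.prems[of N] assms(1) by (simp add: digit_def)
  next
    case False
    then have "n < N" using that by simp
    \<comment> \<open>The new leading part is a multiple of \<open>M ^ Suc n\<close> and therefore
      does not affect digit \<open>n\<close>.\<close>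
    then have "M ^ N = M ^ n * M ^ Suc (N - Suc n)"
      by (simp only: power_add[symmetric]) simp
    then have "M ^ N * s N = M ^ n * (M * (M ^ (N - Suc n) * s N))" by (simp only: power_Suc mult.assoc)
    then have "?w div M ^ n = (w + M ^ n * (M * (M ^ (N - Suc n) * s N))) div M ^ n" by (simp only:)
    also have "\<dots> = w div M ^ n + M * (M ^ (N - Suc n) * s N)" using assms(1) by simp
    finally have "?w div M ^ n = w div M ^ n + M * (M ^ (N - Suc n) * s N)" .
    then show ?thesis using w(2)[OF \<open>n < N\<close>] by (simp add: digit_def)
  qed
  ultimately show ?case by blast
qed simp

lemma digits_eqD: "(\<And>n. n < N \<Longrightarrow> digit M w n = digit M w' n) \<Longrightarrow> w mod M ^ N = w' mod M ^ N"
proof (induction N)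
  case (Suc N)
  have "w mod (M ^ N * M) = M ^ N * digit M w N + w mod M ^ N" for w
    by (simp add: mod_mult2_eq digit_def)
  then show ?case using Suc by (simp add: mult.commute)
qed simp

text \<open>
  One pass over \<open>''bs''\<close> both writes its digits to the output and increments them, with carry \<open>''cy''\<close>.
  No digit is ever extracted by division, which the language lacks; a carry out of the last digit is
  lost, so that counting wraps around at \<open>M^N\<close>.
\<close>

definition emit_prog :: "nat \<Rightarrow> com" where
  "emit_prog M = (let n = ICell ''n'' (IConst 0);
       a = IAdd (IMul (ICell ''v'' (IConst 0)) (ICell ''N'' (IConst 0))) n in
     Seq (RAssign ''Sre'' a (RCell ''ct'' (ICell ''bs'' n)))
    (Seq (RAssign ''Sim'' a (RCell ''st'' (ICell ''bs'' n)))
    (Seq (IAssign ''bs'' n (IAdd (ICell ''bs'' n) (ICell ''cy'' (IConst 0))))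
    (If (ILess (ICell ''bs'' n) (IConst M)) (IAssign ''cy'' (IConst 0) (IConst 0))
        (IAssign ''bs'' n (IConst 0))))))"

definition carry_prog :: com where
  "carry_prog = IAssign ''cy'' (IConst 0) (IConst 1)"

definition list_prog :: "nat \<Rightarrow> com" where
  "list_prog M = For ''v'' 0 (ICell ''K'' (IConst 0)) (Seq carry_prog
     (For ''n'' 0 (ICell ''N'' (IConst 0)) (emit_prog M)))"

definition list_time :: "nat \<Rightarrow> nat \<Rightarrow> nat \<Rightarrow> nat" where
  "list_time M K N = Suc K * (cost carry_prog + Suc N * (cost (emit_prog M) + 14) + 14)"

definition stored :: "nat \<Rightarrow> nat \<Rightarrow> nat \<Rightarrow> nat \<Rightarrow> nat \<Rightarrow> memory \<Rightarrow> bool" where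
  "stored M N w v i \<sigma> \<longleftrightarrow>
     rmem \<sigma> ''Sre'' (v * N + i) = cos (2 * pi * real (digit M (w + v) i) / real M) \<and>
     rmem \<sigma> ''Sim'' (v * N + i) = sin (2 * pi * real (digit M (w + v) i) / real M)"

text \<open>The state in the middle of pass \<open>v\<close>: positions below \<open>n\<close> have
  been written and already carry the digits of the successor, the others still those of
  \<open>w + v\<close>.\<close>

definition listing_inv :: "nat \<Rightarrow> nat \<Rightarrow> nat \<Rightarrow> complex mat \<Rightarrow> nat \<Rightarrow> nat \<Rightarrow> nat \<Rightarrow> nat \<Rightarrow> memory \<Rightarrow> bool" where
  "listing_inv M D N V K w v n \<sigma> \<longleftrightarrow> env M D N V \<sigma> \<and> imem \<sigma> ''K'' 0 = K \<and>
     (\<forall>i<N. imem \<sigma> ''bs'' i = digit M (if i < n then Suc (w + v) else w + v) i) \<and>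
     (\<forall>v'<v. \<forall>i<N. stored M N w v' i \<sigma>) \<and> (\<forall>i<n. stored M N w v i \<sigma>)"

text \<open>Writing one entry of the output leaves all other entries intact.\<close>

lemma row_address_eq: "i < N \<Longrightarrow> i' < N \<Longrightarrow> v * N + i = v' * N + i' \<longleftrightarrow> v = v' \<and> i = i'" for N :: nat
  by (metis add_left_cancel div_mult_self3 div_less add.right_neutral mult.commute not_less_zero)

lemma exec_emit:
  assumes inv: "listing_inv M D N V K w v n \<sigma>" and "n < N" "M > 0"
    and "imem \<sigma> ''v'' 0 = v" "imem \<sigma> ''n'' 0 = n" "imem \<sigma> ''cy'' 0 = of_bool (M ^ n dvd Suc (w + v))"
  defines "\<tau> \<equiv> exec (emit_prog M) \<sigma>"
  shows "listing_inv M D N V K w v (Suc n) \<tau>" "imem \<tau> ''v'' 0 = v" "imem \<tau> ''n'' 0 = n"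
    "imem \<tau> ''cy'' 0 = of_bool (M ^ Suc n dvd Suc (w + v))"
proof -
  let ?W = "w + v"
  have N: "imem \<sigma> ''N'' 0 = N" using inv by (simp add: listing_inv_def env_def)
  have b: "imem \<sigma> ''bs'' n = digit M ?W n" using inv \<open>n < N\<close> by (simp add: listing_inv_def)
  have lt: "digit M ?W n < M" using \<open>M > 0\<close> by (simp add: digit_def)
  define \<rho> where "\<rho> = rwrite ''Sim'' (v * N + n) (sin (2 * pi * real (digit M ?W n) / real M))
    (rwrite ''Sre'' (v * N + n) (cos (2 * pi * real (digit M ?W n) / real M)) \<sigma>)"
  \<comment> \<open>On overflow the digit passes through the value \<open>M\<close> before being
    reset, and the carry cell keeps its 1; otherwise the carry is cleared.\<close>
  have tau: "\<tau> = (if M ^ n dvd Suc ?W \<and> Suc (digit M ?W n) = M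
      then iwrite ''bs'' n 0 (iwrite ''bs'' n M \<rho>)
      else iwrite ''cy'' 0 0 (iwrite ''bs'' n (digit M ?W n + of_bool (M ^ n dvd Suc ?W)) \<rho>))"
    using inv lt by (auto simp: \<tau>_def emit_prog_def Let_def mem_simps assms(4-6) N b \<rho>_def
      listing_inv_def env_def)
  show "imem \<tau> ''v'' 0 = v" "imem \<tau> ''n'' 0 = n" using assms(4,5) by (simp_all add: tau \<rho>_def mem_simps)
  show "imem \<tau> ''cy'' 0 = of_bool (M ^ Suc n dvd Suc (w + v))"
    unfolding power_Suc_dvd_Suc[OF \<open>M > 0\<close>] using assms(6) by (auto simp: tau \<rho>_def mem_simps)
  have bs: "imem \<tau> ''bs'' = (imem \<sigma> ''bs'')(n := digit M (Suc ?W) n)"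
    using \<open>M > 0\<close> by (auto simp: tau \<rho>_def mem_simps digit_Suc)
  have r: "rmem \<tau> = rmem \<rho>" by (simp add: tau mem_simps)
  have "env M D N V \<tau> = env M D N V \<sigma>"
    by (rule env_cong) (auto simp: r \<rho>_def mem_simps tau)
  moreover have "imem \<tau> ''K'' 0 = imem \<sigma> ''K'' 0" by (simp add: tau \<rho>_def mem_simps)
  moreover have "stored M N w v n \<tau>" by (simp add: stored_def r \<rho>_def mem_simps)
  moreover have "stored M N w v' i \<tau>" if "stored M N w v' i \<sigma>" "i < N" "(v', i) \<noteq> (v, n)" for v' i
    using that row_address_eq[OF that(2) \<open>n < N\<close>, of v' v] by (auto simp: stored_def r \<rho>_def mem_simps)
  ultimately show "listing_inv M D N V K w v (Suc n) \<tau>"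
    using inv \<open>n < N\<close> bs by (auto simp: listing_inv_def less_Suc_eq)
qed

lemma listing_inv_iwrite:
  "x \<notin> {''N'', ''K'', ''bs''} \<Longrightarrow>
    listing_inv M D N V K w v n (iwrite x k a \<sigma>) = listing_inv M D N V K w v n \<sigma>"
  by (auto simp: listing_inv_def env_iwrite mem_simps stored_def)

lemma wp_list:
  assumes init: "listing_inv M D N V K w 0 0 \<sigma>" and "M > 0"
  shows "wp (list_prog M) (list_time M K N) (listing_inv M D N V K w K 0) \<sigma>"
  unfolding list_prog_def
proof (rule wp_mono[OF wp_For[where Inv = "\<lambda>v. listing_inv M D N V K w v 0" and n = K
      and T = "cost carry_prog + Suc N * (cost (emit_prog M) + 14)"]])
  show "listing_inv M D N V K w 0 0 (iwrite ''v'' 0 0 \<sigma>)"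
    using init by (simp add: listing_inv_iwrite)
next
  fix v \<rho> assume v: "listing_inv M D N V K w v 0 \<rho>" "imem \<rho> ''v'' 0 = v"
  define Inv where "Inv = (\<lambda>n (\<phi> :: memory). listing_inv M D N V K w v n \<phi> \<and> imem \<phi> ''v'' 0 = v \<and>
    imem \<phi> ''cy'' 0 = of_bool (M ^ n dvd Suc (w + v)))"
  have carry: "wp carry_prog (cost carry_prog) (Inv 0) \<rho>"
    using v by (intro wp_exec) (simp_all add: carry_prog_def Inv_def listing_inv_iwrite mem_simps)
  have row: "wp (For ''n'' 0 (ICell ''N'' (IConst 0)) (emit_prog M)) (Suc N * (cost (emit_prog M) + 14))
      (\<lambda>\<tau>. imem \<tau> ''v'' 0 = v \<and> listing_inv M D N V K w (Suc v) 0 (iwrite ''v'' 0 (Suc v) \<tau>)) \<phi>"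
    if "Inv 0 \<phi>" for \<phi>
  proof (rule wp_mono[OF wp_For[where Inv = Inv and n = N]])
    show "Inv 0 (iwrite ''n'' 0 0 \<phi>)" using that by (simp add: Inv_def listing_inv_iwrite mem_simps)
  next
    fix n \<psi> assume "Inv n \<psi>"
    then show "ival (ICell ''N'' (IConst 0)) \<psi> = N" by (simp add: Inv_def listing_inv_def env_def)
  next
    fix n \<psi> assume n: "n < N" "Inv n \<psi>" "imem \<psi> ''n'' 0 = n"
    then have "listing_inv M D N V K w v n \<psi>" "imem \<psi> ''v'' 0 = v"
      "imem \<psi> ''cy'' 0 = of_bool (M ^ n dvd Suc (w + v))" by (auto simp: Inv_def)
    note ex = exec_emit[OF this(1) n(1) \<open>M > 0\<close> this(2) n(3) this(3)]
    show "wp (emit_prog M) (cost (emit_prog M))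
        (\<lambda>\<tau>. imem \<tau> ''n'' 0 = n \<and> Inv (Suc n) (iwrite ''n'' 0 (Suc n) \<tau>)) \<psi>"
      using ex by (intro wp_exec)
        (simp_all add: emit_prog_def Let_def Inv_def listing_inv_iwrite mem_simps del: exec.simps power_Suc)
  next
    \<comment> \<open>A finished pass over row \<open>v\<close> is the beginning of row
      \<open>Suc v\<close>, all digits having been incremented.\<close>
    fix \<tau> assume "Inv N \<tau> \<and> imem \<tau> ''n'' 0 = N"
    then show "imem \<tau> ''v'' 0 = v \<and> listing_inv M D N V K w (Suc v) 0 (iwrite ''v'' 0 (Suc v) \<tau>)"
      by (auto simp: Inv_def listing_inv_iwrite) (auto simp: listing_inv_def less_Suc_eq)
  qed simp
  show "wp (Seq carry_prog (For ''n'' 0 (ICell ''N'' (IConst 0)) (emit_prog M)))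
    (cost carry_prog + Suc N * (cost (emit_prog M) + 14))
    (\<lambda>\<tau>. imem \<tau> ''v'' 0 = v \<and> listing_inv M D N V K w (Suc v) 0 (iwrite ''v'' 0 (Suc v) \<tau>)) \<rho>"
    by (rule wp_Seq[OF carry row])
next
  fix v \<rho> assume "listing_inv M D N V K w v 0 \<rho>"
  then show "ival (ICell ''K'' (IConst 0)) \<rho> = K" by (simp add: listing_inv_def)
qed (auto simp: list_time_def)

section \<open>Time bounds and the theorem\<close>

text \<open>Bounds over the naturals compose by plain arithmetic; \<open>N = 0\<close> is excluded
  because \<open>N ^ e\<close> vanishes there for positive \<open>e\<close>.\<close>

definition poly_bounded :: "nat \<Rightarrow> (nat \<Rightarrow> nat) \<Rightarrow> bool" where
  "poly_bounded e f \<longleftrightarrow> (\<exists>C. \<forall>N\<ge>1. f N \<le> C * N ^ e)"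

lemma poly_bounded_mono: "poly_bounded a f \<Longrightarrow> a \<le> b \<Longrightarrow> poly_bounded b f"
  unfolding poly_bounded_def by (meson le_trans mult_le_mono2 power_increasing)

lemma poly_bounded_const: "poly_bounded e (\<lambda>N. c)"
  unfolding poly_bounded_def by (intro exI[of _ c]) simp

lemma poly_bounded_ident: "poly_bounded 1 (\<lambda>N. N)"
  unfolding poly_bounded_def by (intro exI[of _ 1]) simp

lemma poly_bounded_add:
  assumes "poly_bounded e f" "poly_bounded e g"
  shows "poly_bounded e (\<lambda>N. f N + g N)"
proof -
  obtain a b where "\<And>N. N \<ge> 1 \<Longrightarrow> f N \<le> a * N ^ e" "\<And>N. N \<ge> 1 \<Longrightarrow> g N \<le> b * N ^ e"
    using assms unfolding poly_bounded_def by blast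
  then have "\<forall>N\<ge>1. f N + g N \<le> (a + b) * N ^ e" by (simp add: distrib_right add_mono)
  then show ?thesis unfolding poly_bounded_def by blast
qed

lemma poly_bounded_mult:
  assumes "poly_bounded a f" "poly_bounded b g"
  shows "poly_bounded (a + b) (\<lambda>N. f N * g N)"
proof -
  obtain A B where "\<And>N. N \<ge> 1 \<Longrightarrow> f N \<le> A * N ^ a" "\<And>N. N \<ge> 1 \<Longrightarrow> g N \<le> B * N ^ b"
    using assms unfolding poly_bounded_def by blast
  then have "f N * g N \<le> (A * N ^ a) * (B * N ^ b)" if "N \<ge> 1" for N
    using that by (intro mult_le_mono) auto
  then have "\<forall>N\<ge>1. f N * g N \<le> (A * B) * N ^ (a + b)" by (simp add: power_add algebra_simps)
  then show ?thesis unfolding poly_bounded_def by blast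
qed

lemma poly_bounded_sum:
  fixes n :: nat
  shows "(\<And>i. i < n \<Longrightarrow> poly_bounded e (f i)) \<Longrightarrow> poly_bounded e (\<lambda>N. \<Sum>i<n. f i N)"
  by (induction n) (auto intro!: poly_bounded_add poly_bounded_const)

lemma poly_bounded_loop:
  assumes "poly_bounded a n" "poly_bounded b f"
  shows "poly_bounded (a + b) (\<lambda>N. Suc (n N) * (f N + c))"
  unfolding Suc_eq_plus1
  by (intro poly_bounded_mult poly_bounded_add poly_bounded_const assms)

lemma poly_bounded_linear: "poly_bounded 1 (\<lambda>N. Suc N * c)"
  using poly_bounded_loop[OF poly_bounded_ident poly_bounded_const, of 0 0 c] by simp

text \<open>Each of the first \<open>L\<close> levels contributes a factor of order
  \<open>N\<close>, every further level only a constant factor.\<close>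

lemma poly_bounded_nest:
  assumes "poly_bounded e f"
  shows "poly_bounded (e + min d L) (\<lambda>N. nest_time (\<lambda>d. if d < L then N else M) d (f N))"
proof (induction d)
  case 0
  then show ?case using assms by simp
next
  case (Suc d)
  show ?case
  proof (cases "d < L")
    case True
    then show ?thesis
      using poly_bounded_loop[OF poly_bounded_ident Suc, of 14] by (simp add: min_def)
  next
    case False
    then show ?thesis
      using poly_bounded_loop[OF poly_bounded_const Suc, of 0 M 14]
      by (simp add: not_less min_absorb2)
  qed
qed

lemma poly_bounded_bigo:
  assumes "poly_bounded e f"
  shows "(\<lambda>N. real (f N)) \<in> O(\<lambda>N. real N ^ e)"
proof -
  obtain C where C: "\<And>N. N \<ge> 1 \<Longrightarrow> f N \<le> C * N ^ e"
    using assms unfolding poly_bounded_def by blast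
  have "eventually (\<lambda>N. norm (real (f N)) \<le> real C * norm (real N ^ e)) sequentially"
    using eventually_ge_at_top[of 1]
  proof eventually_elim
    case (elim N)
    then have "real (f N) \<le> real (C * N ^ e)" using C by (simp only: of_nat_le_iff)
    then show ?case by simp
  qed
  then show ?thesis by (rule bigoI)
qed

lemma poly_bounded_choose: "poly_bounded k (\<lambda>N. N choose k)"
  unfolding poly_bounded_def
  by (intro exI[of _ 1]) (metis binomial_eq_0 binomial_le_pow linorder_not_less mult_1 zero_le)

lemma poly_bounded_num_candidates: "poly_bounded (2 * D - 1) (num_candidates M D)"
proof -
  have "poly_bounded (2 * D - 1) (\<lambda>N. (N choose (2 * d + 1 - i)) * coefficient M d i)" if "d < D" for d i
    using poly_bounded_mult[OF poly_bounded_choose poly_bounded_const[of 0]]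
    by (rule poly_bounded_mono) (use that in simp)
  then have "poly_bounded (2 * D - 1) (\<lambda>N. \<Sum>d<D. \<Sum>i<Suc d. (N choose (2 * d + 1 - i)) * coefficient M d i)"
    by (intro poly_bounded_sum)
  then show ?thesis by (simp only: num_candidates_binomials[abs_def])
qed

lemma poly_bounded_candidate_time: "poly_bounded 1 (\<lambda>N. candidate_time M D N r)"
  unfolding candidate_time_def
  by (intro poly_bounded_add poly_bounded_const poly_bounded_linear)

text \<open>One tuple takes linear time and \<open>2 * D - 1\<close> loops depend on
  \<open>N\<close>, so the exponents add up to \<open>2 * D\<close>.\<close>

lemma poly_bounded_search_time: "D > 0 \<Longrightarrow> poly_bounded (2 * D) (\<lambda>N. search_time M D N)"
proof -
  assume "D > 0"
  let ?L = "2 * D - 1"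
  have "poly_bounded 1 (\<lambda>N. 1 + (\<Sum>r<2 * (2 * D). candidate_time M D N r))"
    by (intro poly_bounded_add poly_bounded_const poly_bounded_sum poly_bounded_candidate_time)
  from poly_bounded_nest[OF this, of "3 * ?L" ?L M]
  have "poly_bounded (2 * D) (\<lambda>N. nest_time (\<lambda>d. if d < ?L then N else M) (3 * ?L)
       (1 + (\<Sum>r<2 * (2 * D). candidate_time M D N r)))"
    by (rule poly_bounded_mono) (use \<open>D > 0\<close> in simp)
  then show ?thesis
    unfolding search_time_def by (intro poly_bounded_add poly_bounded_const)
qed

lemma poly_bounded_count_time: "poly_bounded 1 (\<lambda>N. count_time M D N)"
  unfolding count_time_def
  by (intro poly_bounded_add poly_bounded_const poly_bounded_linear)

lemma poly_bounded_list_time: "poly_bounded (2 * D) (\<lambda>N. list_time M (num_candidates M D N) N)" if "D > 0"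
proof -
  have "poly_bounded 1 (\<lambda>N. cost carry_prog + Suc N * (cost (emit_prog M) + 14))"
    by (intro poly_bounded_add poly_bounded_const poly_bounded_linear)
  from poly_bounded_loop[OF poly_bounded_num_candidates this]
  show ?thesis unfolding list_time_def by (rule poly_bounded_mono) (use that in simp)
qed

section \<open>Symbol vectors and the objective\<close>

definition psk_vec :: "nat \<Rightarrow> nat \<Rightarrow> (nat \<Rightarrow> nat) \<Rightarrow> complex vec" where
  "psk_vec M N s = vec N (\<lambda>n. cis (2 * pi * real (s n) / real M))"

lemma psk_vec_cong: "(\<And>n. n < N \<Longrightarrow> s n = s' n) \<Longrightarrow> psk_vec M N s = psk_vec M N s'"
  by (auto simp: psk_vec_def)

lemma psk_vec_in: "(\<And>n. n < N \<Longrightarrow> s n < M) \<Longrightarrow> psk_vec M N s \<in> mpsk_vecs M N"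
  by (auto simp: psk_vec_def mpsk_vecs_def mpsk_def)

lemma mpsk_vecs_cases:
  assumes "v \<in> mpsk_vecs M N"
  obtains s where "\<And>n. n < N \<Longrightarrow> s n < M" "v = psk_vec M N s"
proof -
  have "\<forall>n\<in>{..<N}. \<exists>m. m < M \<and> v $ n = cis (2 * pi * real m / real M)"
    using assms by (auto simp: mpsk_vecs_def mpsk_def)
  from bchoice[OF this] obtain s where
    "\<forall>n\<in>{..<N}. s n < M \<and> v $ n = cis (2 * pi * real (s n) / real M)" ..
  moreover have "v \<in> carrier_vec N" using assms by (simp add: mpsk_vecs_def)
  ultimately have "\<And>n. n < N \<Longrightarrow> s n < M" "v = psk_vec M N s"
    by (auto simp: psk_vec_def)
  then show thesis by (rule that)
qed

lemma finite_mpsk_vecs: "finite (mpsk_vecs M N)"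
proof (rule finite_subset)
  show "mpsk_vecs M N \<subseteq> psk_vec M N ` ({..<N} \<rightarrow>\<^sub>E {..<M})"
  proof
    fix v assume "v \<in> mpsk_vecs M N"
    then obtain s where s: "\<And>n. n < N \<Longrightarrow> s n < M" "v = psk_vec M N s" by (rule mpsk_vecs_cases) blast
    then have "v = psk_vec M N (restrict s {..<N})" by (auto intro: psk_vec_cong)
    then show "v \<in> psk_vec M N ` ({..<N} \<rightarrow>\<^sub>E {..<M})" using s(1) by auto
  qed
qed (simp add: finite_PiE)

lemma psk_vec_inj:
  assumes "psk_vec M N s = psk_vec M N s'" "\<And>n. n < N \<Longrightarrow> s n < M" "\<And>n. n < N \<Longrightarrow> s' n < M" "n < N"
  shows "s n = s' n"
proof -
  have "M > 0" using assms(2,4) by fastforce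
  then have "inj_on (\<lambda>k. cis (2 * pi * real k / real M)) {..<M}"
    using bij_betw_roots_unity by (auto simp: bij_betw_def)
  moreover have "cis (2 * pi * real (s n) / real M) = cis (2 * pi * real (s' n) / real M)"
    using arg_cong[OF assms(1), of "\<lambda>v. v $ n"] assms(4) by (simp add: psk_vec_def)
  ultimately show ?thesis using assms by (auto dest: inj_onD)
qed

text \<open>Entry \<open>l\<close> of the product is the sum of \<open>cnj (V $$ (n, l))\<close>
  times the symbols; its real part is coordinate \<open>l\<close> and its imaginary part coordinate
  \<open>D + l\<close> of the sum of points. Since \<open>sqrt\<close> is monotone, both quantities
  have the same maximizers.\<close>

lemma objective_psk_vec:
  assumes "V \<in> carrier_mat N D"
  shows "objective V (psk_vec M N s) = sqrt (sqnorm_sum (2 * D) N (point M D V) s)"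
proof -
  let ?s = "psk_vec M N s"
  let ?w = "mat_adjoint V *\<^sub>v ?s"
  have comp: "?w $ l = Complex (\<Sum>n<N. point M D V n (s n) l) (\<Sum>n<N. point M D V n (s n) (D + l))"
    if "l < D" for l
  proof -
    have "?w $ l = (\<Sum>n<N. cnj (V $$ (n, l)) * cis (2 * pi * real (s n) / real M))"
      using assms that
      by (simp add: mat_adjoint_def scalar_prod_def psk_vec_def atLeast0LessThan)
    then show ?thesis using that
      by (simp add: complex_eq_iff point_def sum_subtractf)
  qed
  have "dim_vec ?w = D" using assms by (simp add: mat_adjoint_def)
  then have "objective V ?s = sqrt (\<Sum>l<D. (cmod (?w $ l))\<^sup>2)"
    by (simp add: objective_def euclidean_norm_def L2_set_def)
  also have "(\<Sum>l<D. (cmod (?w $ l))\<^sup>2) = (\<Sum>l<D. (\<Sum>n<N. point M D V n (s n) l)\<^sup>2) +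
      (\<Sum>l<D. (\<Sum>n<N. point M D V n (s n) (D + l))\<^sup>2)"
    by (simp add: comp cmod_power2 sum.distrib)
  also have "\<dots> = sqnorm_sum (2 * D) N (point M D V) s"
  proof -
    have "(\<Sum>l<D. f (D + l)) = sum f {D..<2 * D}" for f :: "nat \<Rightarrow> real"
      using sum.shift_bounds_nat_ivl[of f 0 D D] by (simp add: atLeast0LessThan add.commute mult_2)
    moreover have "{..<2 * D} = {..<D} \<union> {D..<2 * D}" by auto
    moreover have "sum f ({..<D} \<union> {D..<2 * D}) = sum f {..<D} + sum f {D..<2 * D}" for f :: "nat \<Rightarrow> real"
      by (rule sum.union_disjoint) auto
    ultimately show ?thesis unfolding sqnorm_sum_def by simp
  qed
  finally show ?thesis .
qed

lemma output_of_listing: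
  assumes "listing_inv M D N V K w K 0 \<tau>"
  shows "output_vecs N \<tau> = map (\<lambda>v. psk_vec M N (digit M (w + v))) [0..<K]"
proof -
  have "imem \<tau> ''K'' 0 = K" using assms by (simp add: listing_inv_def)
  then show ?thesis using assms
    by (auto simp: output_vecs_def psk_vec_def listing_inv_def stored_def complex_eq_iff)
qed

lemma add_mod_inj:
  fixes v v' :: nat
  assumes "(w + v) mod m = (w + v') mod m" "v < m" "v' < m"
  shows "v = v'"
proof -
  have "a = b" if "(w + a) mod m = (w + b) mod m" "a < m" "b \<le> a" for a b
  proof -
    have "m dvd (w + a) - (w + b)" using that by (subst mod_eq_dvd_iff_nat[symmetric]) auto
    then have "m dvd a - b" by simp
    show ?thesis
    proof (rule ccontr)
      assume "a \<noteq> b"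
      then have "0 < a - b" "a - b < m" using that by auto
      with \<open>m dvd a - b\<close> show False using nat_dvd_not_less by blast
    qed
  qed
  from this[of v v'] this[of v' v] assms show ?thesis by linarith
qed

text \<open>The first \<open>N\<close> digits determine a number modulo \<open>M ^ N\<close>, and at
  most \<open>M ^ N\<close> consecutive numbers are pairwise incongruent; wrapping around therefore
  repeats nothing.\<close>

lemma distinct_listing:
  assumes "M > 0" "K \<le> M ^ N"
  shows "distinct (map (\<lambda>v. psk_vec M N (digit M (w + v))) [0..<K])"
proof -
  have "v = v'" if "v < K" "v' < K" "psk_vec M N (digit M (w + v)) = psk_vec M N (digit M (w + v'))" for v v'
  proof -
    have "(w + v) mod M ^ N = (w + v') mod M ^ N"
      using psk_vec_inj[OF that(3)] assms(1) by (intro digits_eqD) (simp add: digit_def)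
    then show ?thesis by (rule add_mod_inj) (use that assms(2) in auto)
  qed
  then show ?thesis by (auto simp: distinct_map inj_on_def)
qed

text \<open>Needed for the maximizer, which is the first row, to be listed at all. The term for
  \<open>d = 0\<close>, \<open>i = 0\<close> of the reindexed sum is already
  \<open>N\<close>.\<close>

lemma num_candidates_pos: "0 < num_candidates M D N" if "D > 0" "N > 0"
proof -
  have "(N choose 1) * coefficient M 0 0 \<le> (\<Sum>i<Suc 0. (N choose (2 * 0 + 1 - i)) * coefficient M 0 i)" by simp
  also have "\<dots> \<le> num_candidates M D N"
    unfolding num_candidates_binomials
    by (rule member_le_sum[of 0 "{..<D}" "\<lambda>d. \<Sum>i<Suc d. (N choose (2 * d + 1 - i)) * coefficient M d i"])
      (use that in auto)
  finally show ?thesis using that by (simp add: coefficient_def)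
qed

section \<open>Assembly of the algorithm\<close>

definition psk_prog :: "nat \<Rightarrow> nat \<Rightarrow> com" where
  "psk_prog M D = Seq (search_prog M D) (Seq (count_prog M D) (list_prog M))"

definition psk_time :: "nat \<Rightarrow> nat \<Rightarrow> nat \<Rightarrow> nat" where
  "psk_time M D N = search_time M D N + (count_time M D N + list_time M (num_candidates M D N) N)"

lemma psk_prog_correct:
  assumes M: "M > 0" "even M" and "D > 0" "N > 0" and V: "V \<in> carrier_mat N D"
  shows "\<exists>S t. constructs_in_time (psk_prog M D) D N V S t \<and> t \<le> psk_time M D N \<and>
    S \<subseteq> mpsk_vecs M N \<and> card S = num_candidates M D N \<and>
    (\<exists>s\<in>S. \<forall>s'\<in>mpsk_vecs M N. objective V s' \<le> objective V s)"
proof -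
  let ?K = "num_candidates M D N" and ?f = "sqnorm_sum (2 * D) N (point M D V)"
  define opt where "opt = (\<lambda>s. (\<forall>n<N. s n < M) \<and> (\<forall>s'. (\<forall>n<N. s' n < M) \<longrightarrow> ?f s' \<le> ?f s))"
  have list: "wp (Seq (count_prog M D) (list_prog M)) (count_time M D N + list_time M ?K N)
    (\<lambda>\<tau>. \<exists>w. listing_inv M D N V ?K w ?K 0 \<tau> \<and> opt (digit M w)) \<sigma>"
    if env: "env M D N V \<sigma>" and o: "opt (imem \<sigma> ''bs'')" for \<sigma> :: memory
  proof -
    \<comment> \<open>The number \<open>w\<close> exists only in the proof; the program holds its
      digits in \<open>''bs''\<close>.\<close>
    obtain w where w: "\<And>n. n < N \<Longrightarrow> digit M w n = imem \<sigma> ''bs'' n"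
      using digits_exist[OF M(1), of N "imem \<sigma> ''bs''"] o unfolding opt_def by blast
    have "?f (digit M w) = ?f (imem \<sigma> ''bs'')" by (rule sqnorm_sum_cong) (rule w)
    then have "opt (digit M w)" using o w by (simp add: opt_def)
    have N: "imem \<sigma> ''N'' 0 = N" using env by (simp add: env_def)
    show ?thesis
    proof (rule wp_Seq[OF wp_count[OF N]])
      fix \<rho> :: memory assume r: "rmem \<rho> = rmem \<sigma> \<and> imem \<rho> ''N'' = imem \<sigma> ''N'' \<and> imem \<rho> ''bs'' = imem \<sigma> ''bs'' \<and>
        imem \<rho> ''K'' 0 = ?K"
      have "env M D N V \<rho> = env M D N V \<sigma>" by (rule env_cong) (simp_all add: r)
      then have "listing_inv M D N V ?K w 0 0 \<rho>" using env r w by (simp add: listing_inv_def)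
      from wp_list[OF this M(1)]
      show "wp (list_prog M) (list_time M ?K N)
        (\<lambda>\<tau>. \<exists>w. listing_inv M D N V ?K w ?K 0 \<tau> \<and> opt (digit M w)) \<rho>"
        by (rule wp_mono) (use \<open>opt (digit M w)\<close> in auto)
    qed
  qed
  have "wp (psk_prog M D) (psk_time M D N)
    (\<lambda>\<tau>. \<exists>w. listing_inv M D N V ?K w ?K 0 \<tau> \<and> opt (digit M w)) (input_memory D N V)"
    unfolding psk_prog_def psk_time_def
    by (rule wp_Seq[OF wp_search[OF M(1) \<open>D > 0\<close> \<open>N > 0\<close>]]) (rule list, auto simp: opt_def)
  then obtain t \<tau> w where run: "run (psk_prog M D) (input_memory D N V) t \<tau>" "t \<le> psk_time M D N"
    and inv: "listing_inv M D N V ?K w ?K 0 \<tau>" and opt: "opt (digit M w)"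
    unfolding wp_def by blast
  let ?S = "set (output_vecs N \<tau>)"
  note out = output_of_listing[OF inv]
  have dist: "distinct (output_vecs N \<tau>)"
    unfolding out using num_candidates_le_power[OF M(2,1)] by (intro distinct_listing M(1))
  have "?S \<subseteq> mpsk_vecs M N" using M(1) by (auto simp: out digit_def intro!: psk_vec_in)
  moreover have "card ?S = ?K" using distinct_card[OF dist] by (simp add: out)
  moreover have "psk_vec M N (digit M w) \<in> ?S"
    using num_candidates_pos[OF \<open>D > 0\<close> \<open>N > 0\<close>, of M] by (auto simp: out intro!: image_eqI[of _ _ 0])
  moreover have "objective V v \<le> objective V (psk_vec M N (digit M w))" if "v \<in> mpsk_vecs M N" for v
    using that opt by (auto elim!: mpsk_vecs_cases simp: objective_psk_vec[OF V] opt_def)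
  ultimately show ?thesis
    using run dist unfolding constructs_in_time_def by blast
qed

theorem mainTheorem1:
  fixes M D :: nat
  assumes "M \<ge> 2" and "even M" and "D \<ge> 1"
  shows "(\<exists>(P :: com) (T :: nat \<Rightarrow> nat).
            (\<lambda>N. real (T N)) \<in> O(\<lambda>N. real N ^ (2 * D)) \<and>
            (\<lambda>N. real (T N)) \<in> O(\<lambda>N. (real M * real N / 2) ^ (2 * D)) \<and>
            (\<forall>(N :: nat) (V :: complex mat).
               N \<ge> D \<longrightarrow> V \<in> carrier_mat N D \<longrightarrow> vec_space.rank N V = D \<longrightarrow>
               (\<exists>S t. constructs_in_time P D N V S t \<and> t \<le> T N \<and>
                  S \<subseteq> mpsk_vecs M N \<and>
                  Max (objective V ` mpsk_vecs M N) = Max (objective V ` S) \<and>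
                  (\<exists>s\<in>S. is_arg_max (objective V) (\<lambda>s. s \<in> mpsk_vecs M N) s) \<and>
                  card S = num_candidates M D N))) \<and>
         (\<lambda>N. real (num_candidates M D N)) \<in> O(\<lambda>N. real N ^ (2 * D - 1))"
proof (intro conjI exI[of _ "psk_prog M D"] exI[of _ "psk_time M D"] allI impI)
  have "poly_bounded (2 * D) (\<lambda>N. psk_time M D N)"
    unfolding psk_time_def
    using assms by (intro poly_bounded_add poly_bounded_search_time poly_bounded_list_time
        poly_bounded_mono[OF poly_bounded_count_time]) simp_all
  then show *: "(\<lambda>N. real (psk_time M D N)) \<in> O(\<lambda>N. real N ^ (2 * D))" by (rule poly_bounded_bigo)
  \<comment> \<open>The two bounds differ by the factor \<open>(real M / 2) ^ (2 * D)\<close>, a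
    nonzero constant.\<close>
  have "(\<lambda>N. (real M * real N / 2) ^ (2 * D)) = (\<lambda>N. (real M / 2) ^ (2 * D) * real N ^ (2 * D))"
    by (simp add: power_mult_distrib power_divide)
  with * show "(\<lambda>N. real (psk_time M D N)) \<in> O(\<lambda>N. (real M * real N / 2) ^ (2 * D))"
    using assms(1) by simp
next
  show "(\<lambda>N. real (num_candidates M D N)) \<in> O(\<lambda>N. real N ^ (2 * D - 1))"
    by (rule poly_bounded_bigo[OF poly_bounded_num_candidates])
next
  \<comment> \<open>From \<open>D \<ge> 1\<close> and \<open>N \<ge> D\<close> comes the positivity
    of \<open>N\<close> that the correctness lemma requires.\<close>
  fix N and V :: "complex mat" assume "N \<ge> D" and V: "V \<in> carrier_mat N D"
  then obtain S t s where S: "constructs_in_time (psk_prog M D) D N V S t" "t \<le> psk_time M D N"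
    "S \<subseteq> mpsk_vecs M N" "card S = num_candidates M D N" "s \<in> S"
    and max: "\<And>s'. s' \<in> mpsk_vecs M N \<Longrightarrow> objective V s' \<le> objective V s"
    using psk_prog_correct[of M D N V] assms by auto
  have "finite S" using S(1) by (auto simp: constructs_in_time_def)
  have "Max (objective V ` mpsk_vecs M N) = objective V s"
    using finite_mpsk_vecs S(3,5) max by (intro Max_eqI) auto
  moreover have "Max (objective V ` S) = objective V s"
    using \<open>finite S\<close> S(3,5) max by (intro Max_eqI) auto
  moreover have "is_arg_max (objective V) (\<lambda>s. s \<in> mpsk_vecs M N) s"
    using S(3,5) max by (force simp: is_arg_max_def)
  ultimately show "\<exists>S t. constructs_in_time (psk_prog M D) D N V S t \<and> t \<le> psk_time M D N \<and>
      S \<subseteq> mpsk_vecs M N \<and> Max (objective V ` mpsk_vecs M N) = Max (objective V ` S) \<and>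
      (\<exists>s\<in>S. is_arg_max (objective V) (\<lambda>s. s \<in> mpsk_vecs M N) s) \<and> card S = num_candidates M D N"
    using S by (intro exI[of _ S] exI[of _ t]) auto
qed

end
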